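(* Let $\mathcal{M}$ be a smooth manifold and let $\phi\colon \mathbb{R}^n \to \mathcal{M}$ be a diffeomorphism. Then there is a Riemannian metric $h$ on $\mathcal{M}$ (depending only on $\phi$) such that gradient descent for $\min_{y\in\mathbb{R}^n} f(\phi(y))$ is the same as Riemannian gradient descent on $(\mathcal{M},h)$ for $\min_{x\in\mathcal{M}} f(x)$, in the following sense: for every smooth function $f\colon\mathcal{M}\to\mathbb{R}$, every step size $\eta>0$ and every sequence $(y_t)_{t\ge 0}$ in $\mathbb{R}^n$, writing $x_t = \phi(y_t)$, one has \[ y_{t+1} = y_t - \eta\,\nabla (f\circ\phi)(y_t)\quad\text{for all } t\ge 0 \] if and only if \[ x_{t+1} = \exp^{h}_{x_t}\bigl(-\eta\,\nabla^{h} f(x_t)\bigr)\quad\text{for all } t\ge 0 . \]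
   Context: $\nabla(f\circ\phi)$ is the gradient with respect to the standard Euclidean inner product on $\mathbb{R}^n$. For a Riemannian metric $h$ on $\mathcal{M}$, $\nabla^h f$ is the Riemannian gradient of $f$, i.e. the vector field with $\mathrm{d}f = h(\nabla^h f,\cdot)$, and $\exp^h_x\colon T_x\mathcal{M}\to\mathcal{M}$ is the Riemannian exponential map, $\exp^h_x(v)=\gamma_{x,v}(1)$, where $\gamma_{x,v}$ is the geodesic of $h$ (for the Levi-Civita connection) with $\gamma_{x,v}(0)=x$ and $\gamma_{x,v}'(0)=v$; the assertion includes that it is defined at the vectors used. *)

theory Defs
  imports "HOL-Analysis.Analysis"
begin

section \<open>Smooth maps between Euclidean spaces\<close>

text \<open>Intended for open \<open>S\<close> only. In finite dimension a differentiable map is \<open>C\<^sup>k\<^sup>+\<^sup>1\<close>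
  iff all its directional derivatives are \<open>C\<^sup>k\<close>.\<close>

primrec Ck_on :: "nat \<Rightarrow> 'a::euclidean_space set \<Rightarrow> ('a \<Rightarrow> 'b::euclidean_space) \<Rightarrow> bool" where
  "Ck_on 0 S f \<longleftrightarrow> continuous_on S f"
| "Ck_on (Suc k) S f \<longleftrightarrow>
     (\<forall>x\<in>S. f differentiable (at x)) \<and>
     (\<forall>v. Ck_on k S (\<lambda>x. frechet_derivative f (at x) v))"

definition smooth_on :: "'a::euclidean_space set \<Rightarrow> ('a \<Rightarrow> 'b::euclidean_space) \<Rightarrow> bool" where
  "smooth_on S f \<longleftrightarrow> (\<forall>k. Ck_on k S f)"

definition euclidean_gradient :: "('a::euclidean_space \<Rightarrow> real) \<Rightarrow> 'a \<Rightarrow> 'a" where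
  "euclidean_gradient g y = (THE D. GDERIV g y :> D)"


section \<open>Smooth manifolds and smooth maps\<close>

text \<open>A chart is a pair of a domain and a coordinate map, of which only the values on the domain
  matter. The manifold is the whole type \<open>'m\<close>, whose topology is Hausdorff and second countable
  through the sort constraints below. Atlases need not be maximal: all notions below
  depend only on the smooth structure that the atlas generates.\<close>

type_synonym ('m, 'e) atlas = "('m set \<times> ('m \<Rightarrow> 'e)) set"

definition smooth_atlas ::
    "('m::{t2_space,second_countable_topology}, 'e::euclidean_space) atlas \<Rightarrow> bool" where
  "smooth_atlas A \<longleftrightarrow>
     (\<Union>(U, c)\<in>A. U) = UNIV \<and>
     (\<forall>(U, c)\<in>A. open U \<and> open (c ` U) \<and> homeomorphism U (c ` U) c (inv_into U c)) \<and>
     (\<forall>(U, c)\<in>A. \<forall>(V, d)\<in>A. smooth_on (c ` (U \<inter> V)) (d \<circ> inv_into U c))"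

definition euclidean_atlas :: "('a::euclidean_space, 'a) atlas" where
  "euclidean_atlas = {(UNIV, id)}"

text \<open>Smoothness of \<open>f\<close> on an open subset \<open>S\<close> of the manifold with atlas \<open>A\<close>, into the
  manifold with atlas \<open>B\<close>.\<close>

definition smooth_map_on ::
    "('m::topological_space, 'e::euclidean_space) atlas \<Rightarrow>
     ('n::topological_space, 'd::euclidean_space) atlas \<Rightarrow> 'm set \<Rightarrow> ('m \<Rightarrow> 'n) \<Rightarrow> bool" where
  "smooth_map_on A B S f \<longleftrightarrow>
     continuous_on S f \<and>
     (\<forall>(U, c)\<in>A. \<forall>(V, d)\<in>B. smooth_on (c ` (S \<inter> U \<inter> f -` V)) (d \<circ> f \<circ> inv_into U c))"

definition diffeomorphism ::
    "('m::topological_space, 'e::euclidean_space) atlas \<Rightarrow>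
     ('n::topological_space, 'd::euclidean_space) atlas \<Rightarrow> ('m \<Rightarrow> 'n) \<Rightarrow> bool" where
  "diffeomorphism A B \<phi> \<longleftrightarrow>
     bij \<phi> \<and> smooth_map_on A B UNIV \<phi> \<and> smooth_map_on B A UNIV (inv \<phi>)"

definition smooth_fun ::
    "('m::topological_space, 'e::euclidean_space) atlas \<Rightarrow> ('m \<Rightarrow> real) \<Rightarrow> bool" where
  "smooth_fun A f \<longleftrightarrow> smooth_map_on A euclidean_atlas UNIV f"


section \<open>Tangent vectors and vector fields\<close>

text \<open>A tangent vector at \<open>p\<close> is a derivation at \<open>p\<close> of the algebra of smooth functions. As HOL
  functions are total, it is set to \<open>0\<close> on non-smooth functions, so that derivations that agree on
  smooth functions are equal. In particular the differential of \<open>f\<close> is \<open>\<lambda>v. v f\<close>.\<close>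

type_synonym 'm tangent = "('m \<Rightarrow> real) \<Rightarrow> real"

definition tangent_space ::
    "('m::topological_space, 'e::euclidean_space) atlas \<Rightarrow> 'm \<Rightarrow> 'm tangent set" where
  "tangent_space A p = {v.
     (\<forall>f. \<not> smooth_fun A f \<longrightarrow> v f = 0) \<and>
     (\<forall>a b f g. smooth_fun A f \<longrightarrow> smooth_fun A g \<longrightarrow>
        v (\<lambda>x. a * f x + b * g x) = a * v f + b * v g) \<and>
     (\<forall>f g. smooth_fun A f \<longrightarrow> smooth_fun A g \<longrightarrow>
        v (\<lambda>x. f x * g x) = f p * v g + g p * v f)}"

type_synonym 'm vfield = "'m \<Rightarrow> 'm tangent"

definition vector_field ::
    "('m::topological_space, 'e::euclidean_space) atlas \<Rightarrow> 'm vfield \<Rightarrow> bool" where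
  "vector_field A X \<longleftrightarrow>
     (\<forall>p. X p \<in> tangent_space A p) \<and>
     (\<forall>f. smooth_fun A f \<longrightarrow> smooth_fun A (\<lambda>p. X p f))"

definition lie_bracket :: "'m vfield \<Rightarrow> 'm vfield \<Rightarrow> 'm vfield" where
  "lie_bracket X Y = (\<lambda>p f. X p (\<lambda>q. Y q f) - Y p (\<lambda>q. X q f))"


section \<open>Riemannian metrics\<close>

text \<open>Only the values of \<open>h p\<close> on the tangent space at \<open>p\<close> matter. The last condition is
  smoothness of the tensor field, tested on smooth vector fields.\<close>

definition riemannian_metric ::
    "('m::topological_space, 'e::euclidean_space) atlas \<Rightarrow>
     ('m \<Rightarrow> 'm tangent \<Rightarrow> 'm tangent \<Rightarrow> real) \<Rightarrow> bool" where
  "riemannian_metric A h \<longleftrightarrow>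
     (\<forall>p. \<forall>u\<in>tangent_space A p. \<forall>v\<in>tangent_space A p. \<forall>w\<in>tangent_space A p. \<forall>a b.
        h p (\<lambda>f. a * u f + b * v f) w = a * h p u w + b * h p v w) \<and>
     (\<forall>p. \<forall>u\<in>tangent_space A p. \<forall>v\<in>tangent_space A p. h p u v = h p v u) \<and>
     (\<forall>p. \<forall>v\<in>tangent_space A p. v \<noteq> (\<lambda>f. 0) \<longrightarrow> h p v v > 0) \<and>
     (\<forall>X Y. vector_field A X \<longrightarrow> vector_field A Y \<longrightarrow> smooth_fun A (\<lambda>p. h p (X p) (Y p)))"

definition riemannian_gradient ::
    "('m::topological_space, 'e::euclidean_space) atlas \<Rightarrow>
     ('m \<Rightarrow> 'm tangent \<Rightarrow> 'm tangent \<Rightarrow> real) \<Rightarrow> ('m \<Rightarrow> real) \<Rightarrow> 'm vfield" where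
  "riemannian_gradient A h f p =
     (THE w. w \<in> tangent_space A p \<and> (\<forall>v\<in>tangent_space A p. v f = h p w v))"


section \<open>The Levi-Civita connection\<close>

definition affine_connection ::
    "('m::topological_space, 'e::euclidean_space) atlas \<Rightarrow>
     ('m vfield \<Rightarrow> 'm vfield \<Rightarrow> 'm vfield) \<Rightarrow> bool" where
  "affine_connection A D \<longleftrightarrow>
     (\<forall>X Y. vector_field A X \<longrightarrow> vector_field A Y \<longrightarrow> vector_field A (D X Y)) \<and>
     (\<forall>f g X Y Z. smooth_fun A f \<longrightarrow> smooth_fun A g \<longrightarrow>
        vector_field A X \<longrightarrow> vector_field A Y \<longrightarrow> vector_field A Z \<longrightarrow>
        D (\<lambda>p u. f p * X p u + g p * Y p u) Z = (\<lambda>p u. f p * D X Z p u + g p * D Y Z p u)) \<and>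
     (\<forall>a b X Y Z. vector_field A X \<longrightarrow> vector_field A Y \<longrightarrow> vector_field A Z \<longrightarrow>
        D X (\<lambda>p u. a * Y p u + b * Z p u) = (\<lambda>p u. a * D X Y p u + b * D X Z p u)) \<and>
     (\<forall>f X Y. smooth_fun A f \<longrightarrow> vector_field A X \<longrightarrow> vector_field A Y \<longrightarrow>
        D X (\<lambda>p u. f p * Y p u) = (\<lambda>p u. f p * D X Y p u + X p f * Y p u))"

definition is_levi_civita ::
    "('m::topological_space, 'e::euclidean_space) atlas \<Rightarrow>
     ('m \<Rightarrow> 'm tangent \<Rightarrow> 'm tangent \<Rightarrow> real) \<Rightarrow>
     ('m vfield \<Rightarrow> 'm vfield \<Rightarrow> 'm vfield) \<Rightarrow> bool" where
  "is_levi_civita A h D \<longleftrightarrow>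
     affine_connection A D \<and>
     (\<forall>X Y. vector_field A X \<longrightarrow> vector_field A Y \<longrightarrow>
        (\<lambda>p f. D X Y p f - D Y X p f) = lie_bracket X Y) \<and>
     (\<forall>X Y Z. vector_field A X \<longrightarrow> vector_field A Y \<longrightarrow> vector_field A Z \<longrightarrow>
        (\<forall>p. X p (\<lambda>q. h q (Y q) (Z q)) = h p (D X Y p) (Z p) + h p (Y p) (D X Z p)))"

text \<open>The Levi-Civita connection is unique as an operation on smooth vector fields, but its values
  on other arguments are unconstrained; hence \<open>SOME\<close> rather than \<open>THE\<close>.\<close>

definition levi_civita ::
    "('m::topological_space, 'e::euclidean_space) atlas \<Rightarrow>
     ('m \<Rightarrow> 'm tangent \<Rightarrow> 'm tangent \<Rightarrow> real) \<Rightarrow> 'm vfield \<Rightarrow> 'm vfield \<Rightarrow> 'm vfield" where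
  "levi_civita A h = (SOME D. is_levi_civita A h D)"


section \<open>Geodesics and the exponential map\<close>

definition velocity ::
    "('m::topological_space, 'e::euclidean_space) atlas \<Rightarrow> (real \<Rightarrow> 'm) \<Rightarrow> real \<Rightarrow> 'm tangent" where
  "velocity A \<gamma> t = (\<lambda>f. if smooth_fun A f then deriv (f \<circ> \<gamma>) t else 0)"

definition vector_field_along ::
    "('m::topological_space, 'e::euclidean_space) atlas \<Rightarrow> real set \<Rightarrow> (real \<Rightarrow> 'm) \<Rightarrow>
     (real \<Rightarrow> 'm tangent) \<Rightarrow> bool" where
  "vector_field_along A I \<gamma> V \<longleftrightarrow>
     (\<forall>t\<in>I. V t \<in> tangent_space A (\<gamma> t)) \<and>
     (\<forall>f. smooth_fun A f \<longrightarrow> smooth_on I (\<lambda>t. V t f))"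

text \<open>The covariant derivative along \<open>\<gamma>\<close> induced by a connection: the linear operator on vector
  fields along \<open>\<gamma>\<close> that satisfies the Leibniz rule and whose value on the restriction of a vector
  field \<open>Y\<close> of the manifold is the derivative of \<open>Y\<close> in direction of the velocity. The connection
  acts on vector fields only, so that direction enters through any vector field \<open>X\<close> that has
  the value \<open>velocity A \<gamma> t\<close> at \<open>\<gamma> t\<close>.\<close>

definition is_covariant_derivative_along ::
    "('m::topological_space, 'e::euclidean_space) atlas \<Rightarrow>
     ('m vfield \<Rightarrow> 'm vfield \<Rightarrow> 'm vfield) \<Rightarrow> real set \<Rightarrow> (real \<Rightarrow> 'm) \<Rightarrow>
     ((real \<Rightarrow> 'm tangent) \<Rightarrow> real \<Rightarrow> 'm tangent) \<Rightarrow> bool" where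
  "is_covariant_derivative_along A D I \<gamma> Dt \<longleftrightarrow>
     (\<forall>V. vector_field_along A I \<gamma> V \<longrightarrow> vector_field_along A I \<gamma> (Dt V)) \<and>
     (\<forall>a b V W. vector_field_along A I \<gamma> V \<longrightarrow> vector_field_along A I \<gamma> W \<longrightarrow>
        (\<forall>t\<in>I. Dt (\<lambda>s u. a * V s u + b * W s u) t = (\<lambda>u. a * Dt V t u + b * Dt W t u))) \<and>
     (\<forall>f V. smooth_on I f \<longrightarrow> vector_field_along A I \<gamma> V \<longrightarrow>
        (\<forall>t\<in>I. Dt (\<lambda>s u. f s * V s u) t = (\<lambda>u. deriv f t * V t u + f t * Dt V t u))) \<and>
     (\<forall>X Y. vector_field A X \<longrightarrow> vector_field A Y \<longrightarrow>
        (\<forall>t\<in>I. X (\<gamma> t) = velocity A \<gamma> t \<longrightarrow> Dt (Y \<circ> \<gamma>) t = D X Y (\<gamma> t)))"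

definition covariant_derivative_along ::
    "('m::topological_space, 'e::euclidean_space) atlas \<Rightarrow>
     ('m vfield \<Rightarrow> 'm vfield \<Rightarrow> 'm vfield) \<Rightarrow> real set \<Rightarrow> (real \<Rightarrow> 'm) \<Rightarrow>
     (real \<Rightarrow> 'm tangent) \<Rightarrow> real \<Rightarrow> 'm tangent" where
  "covariant_derivative_along A D I \<gamma> = (SOME Dt. is_covariant_derivative_along A D I \<gamma> Dt)"

definition geodesic ::
    "('m::topological_space, 'e::euclidean_space) atlas \<Rightarrow>
     ('m \<Rightarrow> 'm tangent \<Rightarrow> 'm tangent \<Rightarrow> real) \<Rightarrow> real set \<Rightarrow> (real \<Rightarrow> 'm) \<Rightarrow> bool" where
  "geodesic A h I \<gamma> \<longleftrightarrow>
     open I \<and> is_interval I \<and> smooth_map_on euclidean_atlas A I \<gamma> \<and>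
     (\<forall>t\<in>I. covariant_derivative_along A (levi_civita A h) I \<gamma> (velocity A \<gamma>) t = (\<lambda>u. 0))"

text \<open>The domain of the exponential map at \<open>x\<close>: the initial velocities whose geodesic exists up to
  time \<open>1\<close>. Outside it, the value of \<open>riemannian_exp A h x\<close> is meaningless.\<close>

definition riemannian_exp_domain ::
    "('m::topological_space, 'e::euclidean_space) atlas \<Rightarrow>
     ('m \<Rightarrow> 'm tangent \<Rightarrow> 'm tangent \<Rightarrow> real) \<Rightarrow> 'm \<Rightarrow> 'm tangent set" where
  "riemannian_exp_domain A h x = {v \<in> tangent_space A x.
     \<exists>I \<gamma>. geodesic A h I \<gamma> \<and> 0 \<in> I \<and> 1 \<in> I \<and> \<gamma> 0 = x \<and> velocity A \<gamma> 0 = v}"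

definition riemannian_exp ::
    "('m::topological_space, 'e::euclidean_space) atlas \<Rightarrow>
     ('m \<Rightarrow> 'm tangent \<Rightarrow> 'm tangent \<Rightarrow> real) \<Rightarrow> 'm \<Rightarrow> 'm tangent \<Rightarrow> 'm" where
  "riemannian_exp A h x v =
     (THE z. \<exists>I \<gamma>. geodesic A h I \<gamma> \<and> 0 \<in> I \<and> 1 \<in> I \<and> \<gamma> 0 = x \<and> velocity A \<gamma> 0 = v \<and> z = \<gamma> 1)"

end

theory Submission
  imports Defs
begin

text \<open>Take for \<open>h\<close> the metric that makes \<open>\<phi>\<close> an isometry from flat Euclidean space. By Hadamard's
  lemma a derivation at \<open>q\<close> is determined by its values on the coordinate functions of \<open>inv \<phi>\<close>, so
  \<open>h\<close> is the Euclidean inner product of these values, and the gradient of \<open>f\<close> has the Euclidean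
  gradient of \<open>f \<circ> \<phi>\<close> as components. The Levi-Civita connection differentiates components, hence
  the geodesics are exactly the images \<open>\<phi> (y + t *\<^sub>R w)\<close> of straight lines and the exponential map
  at \<open>\<phi> y\<close> is \<open>w \<mapsto> \<phi> (y + w)\<close>. A Riemannian gradient step is thus the \<open>\<phi>\<close>-image of a Euclidean
  one, and \<open>\<phi>\<close> is injective.\<close>

section \<open>Calculus of smooth maps\<close>

text \<open>Openness of \<open>S\<close> is what makes this work: \<open>frechet_derivative\<close>
  is taken in the full space, and at a point of an open set it sees only values on that set.\<close>

lemma Ck_on_cong:
  assumes "open S" "\<And>x. x \<in> S \<Longrightarrow> f x = g x" "Ck_on k S f"
  shows "Ck_on k S g"
  using assms(2,3)
proof (induction k arbitrary: f g)
  case 0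
  then show ?case by (simp cong: continuous_on_cong)
next
  case (Suc k)
  have D: "(g has_derivative frechet_derivative f (at x)) (at x)" if "x \<in> S" for x
  proof (rule has_derivative_transform_within_open[OF _ \<open>open S\<close> that Suc.prems(1)])
    show "(f has_derivative frechet_derivative f (at x)) (at x)"
      using Suc.prems(2) that by (simp add: frechet_derivative_works)
  qed
  then have "frechet_derivative g (at x) = frechet_derivative f (at x)" if "x \<in> S" for x
    using that by (metis frechet_derivative_at)
  then have "Ck_on k S (\<lambda>x. frechet_derivative g (at x) v)" for v
    using Suc.IH[of "\<lambda>x. frechet_derivative f (at x) v"] Suc.prems(2) by simp
  with D show ?case by (auto simp: differentiable_def)
qed

text \<open>Lets the closure proofs below name the derivative of the new function
  explicitly.\<close>

lemma Ck_on_SucI: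
  assumes "open S" "\<And>x. x \<in> S \<Longrightarrow> (f has_derivative f' x) (at x)"
    "\<And>v. Ck_on k S (\<lambda>x. f' x v)"
  shows "Ck_on (Suc k) S f"
proof -
  have "frechet_derivative f (at x) = f' x" if "x \<in> S" for x
    using assms(2) that by (metis frechet_derivative_at)
  then have "Ck_on k S (\<lambda>x. frechet_derivative f (at x) v)" for v
    by (intro Ck_on_cong[OF assms(1) _ assms(3)[of v]]) simp
  then show ?thesis using assms(2) by (auto simp: differentiable_def)
qed

lemma Ck_on_subset: "Ck_on k S f \<Longrightarrow> T \<subseteq> S \<Longrightarrow> Ck_on k T f"
  by (induction k arbitrary: f) (auto intro: continuous_on_subset)

text \<open>Smoothness on a manifold is given chart by chart; this glues the local statements
  together.\<close>

lemma Ck_on_locally: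
  assumes "\<And>x. x \<in> S \<Longrightarrow> \<exists>T. open T \<and> x \<in> T \<and> Ck_on k T f"
  shows "Ck_on k S f"
  using assms
proof (induction k arbitrary: f)
  case 0
  have "isCont f x" if "x \<in> S" for x
    using 0[OF that] continuous_on_eq_continuous_at by auto
  then show ?case by (simp add: continuous_at_imp_continuous_on)
next
  case (Suc k)
  have "f differentiable (at x)" if "x \<in> S" for x
    using Suc.prems[OF that] by auto
  moreover have "Ck_on k S (\<lambda>x. frechet_derivative f (at x) v)" for v
  proof (rule Suc.IH)
    fix x assume "x \<in> S"
    then obtain T where "open T" "x \<in> T" "Ck_on (Suc k) T f" using Suc.prems by blast
    then show "\<exists>T. open T \<and> x \<in> T \<and> Ck_on k T (\<lambda>x. frechet_derivative f (at x) v)" by auto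
  qed
  ultimately show ?case by simp
qed

lemma Ck_on_Suc_imp: "Ck_on (Suc k) S f \<Longrightarrow> Ck_on k S f"
proof (induction k arbitrary: f)
  case 0
  then show ?case
    by (auto intro!: continuous_at_imp_continuous_on differentiable_imp_continuous_within)
next
  case (Suc k)
  then show ?case unfolding Ck_on.simps(2)[of "Suc k"] Ck_on.simps(2)[of k S f] by blast
qed

lemma Ck_on_const: "open S \<Longrightarrow> Ck_on k S (\<lambda>x. c)"
proof (induction k arbitrary: c)
  case (Suc k)
  then show ?case by (intro Ck_on_SucI[where f'="\<lambda>x v. 0"]) auto
qed simp

lemma Ck_on_bounded_linear:
  assumes "open S" "bounded_linear l" "Ck_on k S f"
  shows "Ck_on k S (\<lambda>x. l (f x))"
  using assms(3)
proof (induction k arbitrary: f)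
  case 0
  then show ?case using assms(2) by (simp add: bounded_linear.continuous_on)
next
  case (Suc k)
  then show ?case
    by (intro Ck_on_SucI[where f'="\<lambda>x v. l (frechet_derivative f (at x) v)"] assms(1)
        bounded_linear.has_derivative[OF assms(2)])
      (auto simp: frechet_derivative_works)
qed

lemma Ck_on_ident: "open S \<Longrightarrow> Ck_on k S (\<lambda>x. x)"
proof (induction k)
  case (Suc k)
  then show ?case by (intro Ck_on_SucI[where f'="\<lambda>x v. v"]) (auto intro: Ck_on_const)
qed simp

lemma Ck_on_add:
  assumes "open S" "Ck_on k S f" "Ck_on k S g"
  shows "Ck_on k S (\<lambda>x. f x + g x)"
  using assms(2,3)
proof (induction k arbitrary: f g)
  case 0
  then show ?case by (simp add: continuous_on_add)
next
  case (Suc k)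
  then show ?case
    by (intro Ck_on_SucI[where
          f'="\<lambda>x v. frechet_derivative f (at x) v + frechet_derivative g (at x) v"] assms(1))
      (auto simp: frechet_derivative_works intro!: has_derivative_add)
qed

lemma Ck_on_scaleR:
  fixes f :: "'a::euclidean_space \<Rightarrow> real"
  assumes "open S" "Ck_on k S f" "Ck_on k S g"
  shows "Ck_on k S (\<lambda>x. f x *\<^sub>R g x)"
  using assms(2,3)
proof (induction k arbitrary: f g)
  case 0
  then show ?case by (simp add: continuous_on_scaleR)
next
  case (Suc k)
  show ?case
  proof (rule Ck_on_SucI[OF assms(1)])
    fix x assume "x \<in> S"
    then show "((\<lambda>x. f x *\<^sub>R g x) has_derivative
      (\<lambda>v. f x *\<^sub>R frechet_derivative g (at x) v + frechet_derivative f (at x) v *\<^sub>R g x)) (at x)"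
      using Suc.prems by (auto simp: frechet_derivative_works intro!: has_derivative_scaleR)
  next
    fix v
    show "Ck_on k S (\<lambda>x. f x *\<^sub>R frechet_derivative g (at x) v + frechet_derivative f (at x) v *\<^sub>R g x)"
      \<comment> \<open>Each term of the product rule keeps one factor undifferentiated, so
        \<open>f\<close> and \<open>g\<close> are also needed at order \<open>k\<close>.\<close>
      using Suc.prems Suc.prems[THEN Ck_on_Suc_imp]
      by (intro Ck_on_add assms(1) Suc.IH) auto
  qed
qed

lemma Ck_on_sum:
  assumes "open S" "\<And>i. i \<in> I \<Longrightarrow> Ck_on k S (f i)"
  shows "Ck_on k S (\<lambda>x. \<Sum>i\<in>I. f i x)"
  using assms(2)
  by (induction I rule: infinite_finite_induct) (auto intro: Ck_on_const Ck_on_add assms(1))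

text \<open>\<open>Ck_on\<close> controls derivatives in fixed directions. Linearity reduces a
  direction that varies with the point to the basis directions.\<close>

lemma frechet_derivative_eq_sum_Basis:
  assumes "f differentiable at x"
  shows "frechet_derivative f (at x) v = (\<Sum>b\<in>Basis. (v \<bullet> b) *\<^sub>R frechet_derivative f (at x) b)"
proof -
  interpret linear "frechet_derivative f (at x)"
    by (rule linear_frechet_derivative[OF assms])
  have "frechet_derivative f (at x) v = frechet_derivative f (at x) (\<Sum>b\<in>Basis. (v \<bullet> b) *\<^sub>R b)"
    by (simp add: euclidean_representation)
  then show ?thesis by (simp add: sum scale)
qed

text \<open>The chain rule differentiates \<open>g\<close> in the moving direction
  \<open>?f' x v\<close>. Expansion in the basis fixes the directions, so that the induction
  hypothesis for the derivatives of \<open>g\<close> and the product rule apply.\<close>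

lemma Ck_on_compose:
  assumes "open S" "open T" "Ck_on k T g" "Ck_on k S f" "f \<in> S \<rightarrow> T"
  shows "Ck_on k S (\<lambda>x. g (f x))"
  using assms(3,4)
proof (induction k arbitrary: g)
  case 0
  then show ?case using assms(5) by (auto intro: continuous_on_compose2)
next
  case (Suc k)
  let ?f' = "\<lambda>x. frechet_derivative f (at x)" and ?g' = "\<lambda>y. frechet_derivative g (at y)"
  have dg: "g differentiable at (f x)" if "x \<in> S" for x
    using Suc.prems assms(5) that by auto
  show ?case
  proof (rule Ck_on_SucI[OF assms(1)])
    fix x assume "x \<in> S"
    then have "((\<lambda>x. g (f x)) has_derivative (\<lambda>v. ?g' (f x) (?f' x v))) (at x)"
      using Suc.prems dg by (auto simp: frechet_derivative_works intro: has_derivative_compose)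
    then show "((\<lambda>x. g (f x)) has_derivative
        (\<lambda>v. \<Sum>b\<in>Basis. (?f' x v \<bullet> b) *\<^sub>R ?g' (f x) b)) (at x)"
      by (subst (asm) frechet_derivative_eq_sum_Basis[OF dg[OF \<open>x \<in> S\<close>]])
  next
    fix v
    have "Ck_on k S (\<lambda>x. ?g' (f x) b)" for b
      using Suc.prems(1) Ck_on_Suc_imp[OF Suc.prems(2)] by (intro Suc.IH) auto
    then show "Ck_on k S (\<lambda>x. \<Sum>b\<in>Basis. (?f' x v \<bullet> b) *\<^sub>R ?g' (f x) b)"
      using Suc.prems
      by (intro Ck_on_sum Ck_on_scaleR assms(1)
          Ck_on_bounded_linear[OF _ bounded_linear_inner_left]) auto
  qed
qed

section \<open>Rules for smooth maps, derived from those for each order\<close>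

lemma smooth_on_cong:
  "open S \<Longrightarrow> (\<And>x. x \<in> S \<Longrightarrow> f x = g x) \<Longrightarrow> smooth_on S f \<Longrightarrow> smooth_on S g"
  unfolding smooth_on_def using Ck_on_cong by blast

lemma smooth_on_locally:
  "(\<And>x. x \<in> S \<Longrightarrow> \<exists>T. open T \<and> x \<in> T \<and> smooth_on T f) \<Longrightarrow> smooth_on S f"
  unfolding smooth_on_def by (meson Ck_on_locally)

lemma smooth_on_const: "open S \<Longrightarrow> smooth_on S (\<lambda>x. c)"
  by (simp add: smooth_on_def Ck_on_const)

lemma smooth_on_ident: "open S \<Longrightarrow> smooth_on S (\<lambda>x. x)"
  by (simp add: smooth_on_def Ck_on_ident)

lemma smooth_on_bounded_linear:
  "open S \<Longrightarrow> bounded_linear l \<Longrightarrow> smooth_on S f \<Longrightarrow> smooth_on S (\<lambda>x. l (f x))"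
  by (simp add: smooth_on_def Ck_on_bounded_linear)

lemma smooth_on_add:
  "open S \<Longrightarrow> smooth_on S f \<Longrightarrow> smooth_on S g \<Longrightarrow> smooth_on S (\<lambda>x. f x + g x)"
  by (simp add: smooth_on_def Ck_on_add)

lemma smooth_on_scaleR:
  fixes f :: "'a::euclidean_space \<Rightarrow> real"
  shows "open S \<Longrightarrow> smooth_on S f \<Longrightarrow> smooth_on S g \<Longrightarrow> smooth_on S (\<lambda>x. f x *\<^sub>R g x)"
  by (simp add: smooth_on_def Ck_on_scaleR)

lemma smooth_on_mult:
  fixes f g :: "'a::euclidean_space \<Rightarrow> real"
  shows "open S \<Longrightarrow> smooth_on S f \<Longrightarrow> smooth_on S g \<Longrightarrow> smooth_on S (\<lambda>x. f x * g x)"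
  using smooth_on_scaleR[of S f g] by simp

lemma smooth_on_sum:
  "open S \<Longrightarrow> (\<And>i. i \<in> I \<Longrightarrow> smooth_on S (f i)) \<Longrightarrow> smooth_on S (\<lambda>x. \<Sum>i\<in>I. f i x)"
  by (simp add: smooth_on_def Ck_on_sum)

lemma smooth_on_compose:
  "open S \<Longrightarrow> open T \<Longrightarrow> smooth_on T g \<Longrightarrow> smooth_on S f \<Longrightarrow> f \<in> S \<rightarrow> T \<Longrightarrow>
    smooth_on S (\<lambda>x. g (f x))"
  by (simp add: smooth_on_def Ck_on_compose)

lemma smooth_on_differentiable: "smooth_on S f \<Longrightarrow> x \<in> S \<Longrightarrow> f differentiable at x"
  using Ck_on.simps(2)[of 0 S f] by (simp add: smooth_on_def del: Ck_on.simps)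

lemma smooth_on_continuous_on: "smooth_on S f \<Longrightarrow> continuous_on S f"
  using Ck_on.simps(1)[of S f] by (simp add: smooth_on_def del: Ck_on.simps)

lemma smooth_on_has_derivative:
  "smooth_on S f \<Longrightarrow> x \<in> S \<Longrightarrow> (f has_derivative frechet_derivative f (at x)) (at x)"
  by (metis smooth_on_differentiable frechet_derivative_works)

lemma smooth_on_frechet_derivative:
  "smooth_on S f \<Longrightarrow> smooth_on S (\<lambda>x. frechet_derivative f (at x) v)"
  using Ck_on.simps(2)[of _ S f] by (simp add: smooth_on_def del: Ck_on.simps)

lemma smooth_on_has_real_derivative:
  fixes f :: "real \<Rightarrow> real"
  assumes "smooth_on S f" "x \<in> S"
  shows "(f has_real_derivative deriv f x) (at x)"
  using smooth_on_differentiable[OF assms]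
  by (simp add: DERIV_deriv_iff_real_differentiable)

lemma frechet_derivative_eq_deriv:
  fixes f :: "real \<Rightarrow> real"
  assumes "f differentiable at x"
  shows "frechet_derivative f (at x) v = v * deriv f x"
proof -
  have "(f has_derivative (*) (deriv f x)) (at x)"
    using assms DERIV_deriv_iff_real_differentiable has_field_derivative_def by blast
  then have "frechet_derivative f (at x) = (*) (deriv f x)"
    by (metis frechet_derivative_at)
  then show ?thesis by simp
qed

lemma smooth_on_deriv:
  fixes f :: "real \<Rightarrow> real"
  assumes "open S" "smooth_on S f"
  shows "smooth_on S (deriv f)"
  using smooth_on_cong[OF assms(1) _ smooth_on_frechet_derivative[OF assms(2), of 1]]
    frechet_derivative_eq_deriv smooth_on_differentiable[OF assms(2)] by simp

text \<open>The weight \<open>t ^ m\<close> absorbs the factor \<open>t\<close> that each differentiation in \<open>x\<close> produces.\<close>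

lemma Ck_on_integral:
  fixes G :: "'a::euclidean_space \<Rightarrow> real"
  assumes "smooth_on UNIV G"
  shows "Ck_on k UNIV (\<lambda>x. integral {0..1} (\<lambda>t. t ^ m * G (y + t *\<^sub>R (x - y))))"
  using assms
proof (induction k arbitrary: m G)
  case 0
  have "continuous_on (UNIV \<times> cbox 0 1) (\<lambda>(x, t). t ^ m * G (y + t *\<^sub>R (x - y)))"
    unfolding split_def
    by (intro continuous_intros
        continuous_on_compose2[OF smooth_on_continuous_on[OF 0]]) auto
  from integral_continuous_on_param[OF this] show ?case by simp
next
  case (Suc k)
  let ?D = "\<lambda>x t v. frechet_derivative G (at (y + t *\<^sub>R (x - y))) v"
  \<comment> \<open>\<open>leibniz_rule\<close> takes the derivative as an element of the space of
    bounded linear maps and integrates it there.\<close>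
  let ?F = "\<lambda>x t. Blinfun (\<lambda>v. t ^ Suc m * ?D x t v)"
  have dG: "(G has_derivative frechet_derivative G (at z)) (at z)" for z
    using smooth_on_has_derivative[OF Suc.prems] by simp
  have F: "blinfun_apply (?F x t) v = t ^ Suc m * ?D x t v" for x t v
    using has_derivative_bounded_linear[OF dG]
    by (subst bounded_linear_Blinfun_apply) (auto intro!: bounded_linear_intros)
  \<comment> \<open>In finite dimension, continuity into the bounded linear maps can be checked on
    basis vectors.\<close>
  have cont: "continuous_on (UNIV \<times> cbox 0 1) (\<lambda>(x, t). ?F x t)"
  proof (rule continuous_on_blinfun_componentwise)
    fix i :: 'a
    show "continuous_on (UNIV \<times> cbox 0 1) (\<lambda>z. blinfun_apply (case z of (x, t) \<Rightarrow> ?F x t) i)"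
      unfolding split_def F
      by (intro continuous_intros continuous_on_compose2[OF
          smooth_on_continuous_on[OF smooth_on_frechet_derivative[OF Suc.prems]]]) auto
  qed
  have "((\<lambda>x. integral (cbox 0 1) (\<lambda>t. t ^ m * G (y + t *\<^sub>R (x - y)))) has_derivative
      integral (cbox 0 1) (?F x)) (at x within UNIV)" for x
  proof (rule leibniz_rule[OF _ _ cont])
    fix x :: "'a" and t :: real
    have "((\<lambda>x. t ^ m * G (y + t *\<^sub>R (x - y))) has_derivative
        (\<lambda>v. t ^ m * frechet_derivative G (at (y + t *\<^sub>R (x - y))) (t *\<^sub>R v))) (at x)"
      by (rule has_derivative_mult_right, rule has_derivative_compose[OF _ dG])
        (auto intro!: derivative_eq_intros)
    moreover have "?D x t (t *\<^sub>R v) = t * ?D x t v" for v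
      using linear_cmul[OF has_derivative_linear[OF dG]] by simp
    ultimately show "((\<lambda>x. t ^ m * G (y + t *\<^sub>R (x - y))) has_derivative blinfun_apply (?F x t))
        (at x within UNIV)"
      unfolding F by (simp add: mult_ac)
  next
    fix x show "(\<lambda>t. t ^ m * G (y + t *\<^sub>R (x - y))) integrable_on cbox 0 1"
      by (intro integrable_continuous continuous_intros
          continuous_on_compose2[OF smooth_on_continuous_on[OF Suc.prems]]) auto
  qed auto
  moreover have "blinfun_apply (integral (cbox 0 1) (?F x)) v =
      integral {0..1} (\<lambda>t. t ^ Suc m * ?D x t v)" for x v
  proof -
    have F_cont: "continuous_on (cbox 0 1) (?F x)"
    proof -
      have "continuous_on (cbox 0 1) (\<lambda>t::real. (x, t))" by (intro continuous_intros)
      from continuous_on_compose2[OF cont this] show ?thesis by auto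
    qed
    show ?thesis
      unfolding blinfun_apply_integral[OF integrable_continuous[OF F_cont]] F by simp
  qed
  \<comment> \<open>The new integrand has the original form, with \<open>G\<close> replaced by a
    directional derivative and \<open>m\<close> by \<open>Suc m\<close>.\<close>
  moreover have "Ck_on k UNIV (\<lambda>x. integral {0..1} (\<lambda>t. t ^ Suc m * ?D x t v))" for v
    by (rule Suc.IH[OF smooth_on_frechet_derivative[OF Suc.prems]])
  ultimately show ?case
    using Ck_on_SucI[of UNIV _ "\<lambda>x. blinfun_apply (integral (cbox 0 1) (?F x))" k]
    by (simp only: open_UNIV box_real)
qed

text \<open>\<open>G b\<close> is the mean of the partial derivative of \<open>g\<close> in
  direction \<open>b\<close> over the segment from \<open>y\<close> to \<open>x\<close>. The
  identity is the fundamental theorem of calculus along that segment; at \<open>x = y\<close> the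
  integrand is constant.\<close>

lemma hadamard:
  fixes g :: "'a::euclidean_space \<Rightarrow> real"
  assumes "smooth_on UNIV g"
  obtains G where "\<And>b. smooth_on UNIV (G b)"
    "\<And>x. g x = g y + (\<Sum>b\<in>Basis. ((x - y) \<bullet> b) * G b x)"
    "\<And>b. G b y = frechet_derivative g (at y) b"
proof
  let ?G = "\<lambda>b x. integral {0..1} (\<lambda>t. frechet_derivative g (at (y + t *\<^sub>R (x - y))) b)"
  show "smooth_on UNIV (?G b)" for b
    unfolding smooth_on_def
    using Ck_on_integral[OF smooth_on_frechet_derivative[OF assms], of _ 0] by simp
  show "?G b y = frechet_derivative g (at y) b" for b by simp
  fix x
  let ?D = "\<lambda>t. frechet_derivative g (at (y + t *\<^sub>R (x - y)))"
  have dg: "(g has_derivative frechet_derivative g (at z)) (at z)" for z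
    using smooth_on_has_derivative[OF assms] by simp
  have "((\<lambda>t. g (y + t *\<^sub>R (x - y))) has_vector_derivative ?D t (x - y)) (at t within {0..1})" for t
  proof -
    have "((\<lambda>t. g (y + t *\<^sub>R (x - y))) has_derivative (\<lambda>s. ?D t (s *\<^sub>R (x - y)))) (at t)"
      by (rule has_derivative_compose[OF _ dg]) (auto intro!: derivative_eq_intros)
    then show ?thesis
      using linear_cmul[OF has_derivative_linear[OF dg]]
      by (simp add: has_vector_derivative_def has_derivative_at_withinI)
  qed
  then have "((\<lambda>t. ?D t (x - y)) has_integral g (y + 1 *\<^sub>R (x - y)) - g (y + 0 *\<^sub>R (x - y))) {0..1}"
    by (intro fundamental_theorem_of_calculus) auto
  then have "g x - g y = integral {0..1} (\<lambda>t. ?D t (x - y))"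
    by (simp add: integral_unique)
  also have "\<dots> = integral {0..1} (\<lambda>t. \<Sum>b\<in>Basis. ((x - y) \<bullet> b) * ?D t b)"
    using frechet_derivative_eq_sum_Basis[OF smooth_on_differentiable[OF assms], of _ "x - y"]
    by simp
  also have "\<dots> = (\<Sum>b\<in>Basis. integral {0..1} (\<lambda>t. ((x - y) \<bullet> b) * ?D t b))"
    by (intro integral_sum finite_Basis integrable_continuous_real continuous_intros
        continuous_on_compose2[OF
          smooth_on_continuous_on[OF smooth_on_frechet_derivative[OF assms]]]) auto
  finally show "g x = g y + (\<Sum>b\<in>Basis. ((x - y) \<bullet> b) * ?G b x)" by simp
qed

text \<open>The gradient is defined by \<open>THE\<close>, so it must be shown to exist, as the
  vector of partial derivatives, and to be unique, by nondegeneracy of the inner product.\<close>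

lemma euclidean_gradient_inner:
  fixes g :: "'a::euclidean_space \<Rightarrow> real"
  assumes "g differentiable at y"
  shows "frechet_derivative g (at y) w = w \<bullet> euclidean_gradient g y"
proof -
  let ?D = "\<Sum>b\<in>Basis. frechet_derivative g (at y) b *\<^sub>R b"
  have D: "frechet_derivative g (at y) = (\<lambda>w. w \<bullet> ?D)"
  proof
    fix w show "frechet_derivative g (at y) w = w \<bullet> ?D"
      by (subst frechet_derivative_eq_sum_Basis[OF assms])
        (simp add: inner_sum_right mult.commute)
  qed
  have "(g has_derivative (\<lambda>w. w \<bullet> ?D)) (at y)"
    using assms D by (simp add: frechet_derivative_works)
  then have "GDERIV g y :> ?D" by (simp add: gderiv_def)
  moreover have "E = ?D" if "GDERIV g y :> E" for E
  proof -
    have "(\<lambda>w. w \<bullet> E) = (\<lambda>w. w \<bullet> ?D)"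
      by (rule trans[OF frechet_derivative_at[OF that[unfolded gderiv_def]] D])
    then have "w \<bullet> E = w \<bullet> ?D" for w by (rule fun_cong)
    then show ?thesis using vector_eq_ldot by blast
  qed
  ultimately have "euclidean_gradient g y = ?D"
    unfolding euclidean_gradient_def by blast
  then show ?thesis using fun_cong[OF D, of w] by (simp only:)
qed

section \<open>Tangent vectors and the pulled back metric\<close>

text \<open>The source is an arbitrary Euclidean space \<open>'a\<close>; \<open>real ^ 'n\<close>
  enters only in the final theorem.\<close>

locale euclidean_diffeo =
  fixes A :: "('m::{t2_space,second_countable_topology}, 'e::euclidean_space) atlas"
    and \<phi> :: "'a::euclidean_space \<Rightarrow> 'm"
  assumes atlas: "smooth_atlas A"
    and diffeo: "diffeomorphism euclidean_atlas A \<phi>"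
begin

lemma inv_diffeo [simp]: "inv \<phi> (\<phi> x) = x" "\<phi> (inv \<phi> q) = q"
  using diffeo by (auto simp: diffeomorphism_def bij_def inv_f_f surj_f_inv_f)

lemma continuous_on_diffeo: "continuous_on UNIV \<phi>" "continuous_on UNIV (inv \<phi>)"
  using diffeo by (auto simp: diffeomorphism_def smooth_map_on_def)

text \<open>The last two facts express that each chart is compatible with \<open>inv \<phi>\<close>,
  regarded as a global chart.\<close>

lemma chart:
  assumes "(U, c) \<in> A"
  shows "open U" "open (c ` U)" "continuous_on U c"
    and "\<And>q. q \<in> U \<Longrightarrow> inv_into U c (c q) = q"
    and "smooth_on (\<phi> -` U) (c \<circ> \<phi>)" "smooth_on (c ` U) (inv \<phi> \<circ> inv_into U c)"
proof -
  have "homeomorphism U (c ` U) c (inv_into U c)" "open U" "open (c ` U)"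
    using atlas assms by (auto simp: smooth_atlas_def)
  then show "open U" "open (c ` U)" "continuous_on U c"
    "\<And>q. q \<in> U \<Longrightarrow> inv_into U c (c q) = q"
    by (auto simp: homeomorphism_def)
  show "smooth_on (\<phi> -` U) (c \<circ> \<phi>)" "smooth_on (c ` U) (inv \<phi> \<circ> inv_into U c)"
    using diffeo assms
    by (auto simp: diffeomorphism_def smooth_map_on_def euclidean_atlas_def)
qed

lemma chart_at:
  obtains U c where "(U, c) \<in> A" "q \<in> U"
proof -
  have "q \<in> (\<Union>(U, c)\<in>A. U)" using atlas by (simp add: smooth_atlas_def)
  then show ?thesis using that by auto
qed

text \<open>Smoothness can be tested in the single global chart \<open>inv \<phi>\<close>: both
  directions insert a chart and compose with a smooth transition map. From here on, analysis on the
  manifold is calculus on \<open>'a\<close>.\<close>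

lemma smooth_fun_iff: "smooth_fun A u \<longleftrightarrow> smooth_on UNIV (\<lambda>x. u (\<phi> x))"
proof
  assume u: "smooth_fun A u"
  show "smooth_on UNIV (\<lambda>x. u (\<phi> x))"
  proof (rule smooth_on_locally)
    fix x
    obtain U c where Uc: "(U, c) \<in> A" "\<phi> x \<in> U" by (rule chart_at)
    have u_c: "smooth_on (c ` U) (u \<circ> inv_into U c)"
      using u Uc(1) by (auto simp: smooth_fun_def smooth_map_on_def euclidean_atlas_def)
    have "open (\<phi> -` U)"
      using chart(1)[OF Uc(1)] continuous_on_diffeo(1) by (rule open_vimage)
    then have "smooth_on (\<phi> -` U) (\<lambda>x. (u \<circ> inv_into U c) ((c \<circ> \<phi>) x))"
      by (rule smooth_on_compose[OF _ chart(2)[OF Uc(1)] u_c chart(5)[OF Uc(1)]]) auto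
    from smooth_on_cong[OF \<open>open (\<phi> -` U)\<close> _ this]
    have "smooth_on (\<phi> -` U) (\<lambda>x. u (\<phi> x))"
      using chart(4)[OF Uc(1)] by simp
    then show "\<exists>T. open T \<and> x \<in> T \<and> smooth_on T (\<lambda>x. u (\<phi> x))"
      using \<open>open (\<phi> -` U)\<close> Uc(2) by blast
  qed
next
  assume u: "smooth_on UNIV (\<lambda>x. u (\<phi> x))"
  have "continuous_on UNIV (\<lambda>q. u (\<phi> (inv \<phi> q)))"
    using continuous_on_compose2[OF smooth_on_continuous_on[OF u] continuous_on_diffeo(2)]
    by simp
  moreover have "smooth_on (c ` U) (u \<circ> inv_into U c)" if "(U, c) \<in> A" for U c
    using smooth_on_compose[OF chart(2)[OF that] open_UNIV u chart(6)[OF that]]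
    by (simp add: o_def)
  ultimately show "smooth_fun A u"
    by (auto simp: smooth_fun_def smooth_map_on_def euclidean_atlas_def)
qed

text \<open>The counterpart for maps into the manifold, used for curves. Continuity of
  \<open>\<gamma>\<close> makes the preimages of chart domains open.\<close>

lemma smooth_map_on_iff:
  fixes \<gamma> :: "'b::euclidean_space \<Rightarrow> 'm"
  assumes "open S"
  shows "smooth_map_on euclidean_atlas A S \<gamma> \<longleftrightarrow> smooth_on S (\<lambda>t. inv \<phi> (\<gamma> t))"
proof
  assume g: "smooth_map_on euclidean_atlas A S \<gamma>"
  show "smooth_on S (\<lambda>t. inv \<phi> (\<gamma> t))"
  proof (rule smooth_on_locally)
    fix t assume "t \<in> S"
    obtain U c where Uc: "(U, c) \<in> A" "\<gamma> t \<in> U" by (rule chart_at)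
    let ?T = "S \<inter> \<gamma> -` U"
    have "open ?T"
      using g assms chart(1)[OF Uc(1)]
      by (auto simp: smooth_map_on_def intro: continuous_open_preimage)
    have "smooth_on ?T (c \<circ> \<gamma>)"
      using g Uc(1) by (auto simp: smooth_map_on_def euclidean_atlas_def)
    then have "smooth_on ?T (\<lambda>t. (inv \<phi> \<circ> inv_into U c) ((c \<circ> \<gamma>) t))"
      by (rule smooth_on_compose[OF \<open>open ?T\<close> chart(2)[OF Uc(1)] chart(6)[OF Uc(1)]]) auto
    from smooth_on_cong[OF \<open>open ?T\<close> _ this]
    have "smooth_on ?T (\<lambda>t. inv \<phi> (\<gamma> t))"
      using chart(4)[OF Uc(1)] by simp
    then show "\<exists>T. open T \<and> t \<in> T \<and> smooth_on T (\<lambda>t. inv \<phi> (\<gamma> t))"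
      using \<open>open ?T\<close> \<open>t \<in> S\<close> Uc(2) by blast
  qed
next
  assume g: "smooth_on S (\<lambda>t. inv \<phi> (\<gamma> t))"
  have "continuous_on S (\<lambda>t. \<phi> (inv \<phi> (\<gamma> t)))"
    by (rule continuous_on_compose2[OF continuous_on_diffeo(1) smooth_on_continuous_on[OF g]]) auto
  then have cont: "continuous_on S \<gamma>" by simp
  moreover have "smooth_on (S \<inter> \<gamma> -` U) (c \<circ> \<gamma>)" if "(U, c) \<in> A" for U c
  proof -
    have o: "open (S \<inter> \<gamma> -` U)" "open (\<phi> -` U)"
      using cont assms chart(1)[OF that] continuous_on_diffeo(1)
      by (auto intro: continuous_open_preimage open_vimage)
    have g': "smooth_on (S \<inter> \<gamma> -` U) (\<lambda>t. inv \<phi> (\<gamma> t))"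
      using g unfolding smooth_on_def by (blast intro: Ck_on_subset)
    have "smooth_on (S \<inter> \<gamma> -` U) (\<lambda>t. (c \<circ> \<phi>) (inv \<phi> (\<gamma> t)))"
      by (rule smooth_on_compose[OF o chart(5)[OF that] g']) auto
    then show ?thesis by (simp add: o_def)
  qed
  ultimately show "smooth_map_on euclidean_atlas A S \<gamma>"
    by (auto simp: smooth_map_on_def euclidean_atlas_def)
qed

section \<open>Smooth functions and coordinates on the manifold\<close>

lemma smooth_fun_const: "smooth_fun A (\<lambda>q. a)"
  by (simp add: smooth_fun_iff smooth_on_const)

lemma smooth_fun_mult: "smooth_fun A f \<Longrightarrow> smooth_fun A g \<Longrightarrow> smooth_fun A (\<lambda>q. f q * g q)"
  by (simp add: smooth_fun_iff smooth_on_mult)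

lemma smooth_fun_add: "smooth_fun A f \<Longrightarrow> smooth_fun A g \<Longrightarrow> smooth_fun A (\<lambda>q. f q + g q)"
  by (simp add: smooth_fun_iff smooth_on_add)

lemma smooth_fun_sum:
  "(\<And>i. i \<in> I \<Longrightarrow> smooth_fun A (f i)) \<Longrightarrow> smooth_fun A (\<lambda>q. \<Sum>i\<in>I. f i q)"
  by (simp add: smooth_fun_iff smooth_on_sum)

text \<open>For \<open>b\<close> in \<open>Basis\<close> these are the coordinates of the global
  chart. They are smooth on the whole manifold, so derivations act on them directly, without cutoff
  functions.\<close>

definition coord :: "'a \<Rightarrow> 'm \<Rightarrow> real" where
  "coord b q = inv \<phi> q \<bullet> b"

lemma smooth_fun_coord: "smooth_fun A (coord b)"
  by (simp add: smooth_fun_iff coord_def smooth_on_bounded_linear[OF open_UNIV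
        bounded_linear_inner_left] smooth_on_ident)

lemmas smooth_fun_intros =
  smooth_fun_const smooth_fun_mult smooth_fun_add smooth_fun_sum smooth_fun_coord

text \<open>The differential of \<open>\<phi>\<close>, indexed by the image point \<open>q\<close>.
  The value \<open>0\<close> on non-smooth functions follows the convention of
  \<open>tangent_space\<close>.\<close>

definition push :: "'m \<Rightarrow> 'a \<Rightarrow> 'm tangent" where
  "push q w u = (if smooth_fun A u then frechet_derivative (\<lambda>x. u (\<phi> x)) (at (inv \<phi> q)) w else 0)"

text \<open>On tangent vectors this inverts \<open>push q\<close>, by \<open>comps_push\<close> and
  \<open>push_comps\<close>.\<close>

definition comps :: "'m tangent \<Rightarrow> 'a" where
  "comps v = (\<Sum>b\<in>Basis. v (coord b) *\<^sub>R b)"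

lemma comps_inner: "b \<in> Basis \<Longrightarrow> comps v \<bullet> b = v (coord b)"
  by (simp add: comps_def)

lemma tangent_nonsmooth: "v \<in> tangent_space A q \<Longrightarrow> \<not> smooth_fun A f \<Longrightarrow> v f = 0"
  by (simp add: tangent_space_def)

lemma tangent_lincomb:
  "v \<in> tangent_space A q \<Longrightarrow> smooth_fun A f \<Longrightarrow> smooth_fun A g \<Longrightarrow>
    v (\<lambda>x. a * f x + b * g x) = a * v f + b * v g"
  by (simp add: tangent_space_def)

lemma tangent_add:
  "v \<in> tangent_space A q \<Longrightarrow> smooth_fun A f \<Longrightarrow> smooth_fun A g \<Longrightarrow>
    v (\<lambda>x. f x + g x) = v f + v g"
  using tangent_lincomb[of v q f g 1 1] by simp

lemma tangent_mult:
  "v \<in> tangent_space A q \<Longrightarrow> smooth_fun A f \<Longrightarrow> smooth_fun A g \<Longrightarrow>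
    v (\<lambda>x. f x * g x) = f q * v g + g q * v f"
  by (simp add: tangent_space_def)

lemma tangent_const:
  assumes "v \<in> tangent_space A q"
  shows "v (\<lambda>x. a) = 0"
proof -
  \<comment> \<open>The Leibniz rule for \<open>1 * 1\<close> gives
    \<open>v 1 = 2 * v 1\<close>.\<close>
  have "v (\<lambda>x. 1) = 0"
    using tangent_mult[OF assms smooth_fun_const[of 1] smooth_fun_const[of 1]] by simp
  then show ?thesis
    using tangent_lincomb[OF assms smooth_fun_const[of 1] smooth_fun_const[of 1], of a 0] by simp
qed

lemma tangent_sum:
  assumes "v \<in> tangent_space A q" "\<And>i. i \<in> I \<Longrightarrow> smooth_fun A (f i)"
  shows "v (\<lambda>x. \<Sum>i\<in>I. f i x) = (\<Sum>i\<in>I. v (f i))"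
  using assms(2)
  by (induction I rule: infinite_finite_induct)
    (simp_all add: tangent_const[OF assms(1)] tangent_add[OF assms(1)] smooth_fun_sum)

lemma lincomb_tangent:
  "u \<in> tangent_space A q \<Longrightarrow> v \<in> tangent_space A q \<Longrightarrow>
    (\<lambda>f. a * u f + b * v f) \<in> tangent_space A q"
  by (simp add: tangent_space_def algebra_simps)

lemma scale_tangent: "u \<in> tangent_space A q \<Longrightarrow> (\<lambda>f. a * u f) \<in> tangent_space A q"
  using lincomb_tangent[of u q u a 0] by simp

lemma zero_tangent: "(\<lambda>f. 0) \<in> tangent_space A q"
  by (simp add: tangent_space_def)

lemma push_eqI:
  assumes "smooth_fun A u" "((\<lambda>x. u (\<phi> x)) has_derivative D) (at (inv \<phi> q))"
  shows "push q w u = D w"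
  using assms frechet_derivative_at[OF assms(2)] by (simp add: push_def)

lemma push_has_derivative:
  assumes "smooth_fun A u"
  shows "((\<lambda>x. u (\<phi> x)) has_derivative (\<lambda>w. push q w u)) (at (inv \<phi> q))"
  using smooth_on_has_derivative[of UNIV] assms by (simp add: push_def smooth_fun_iff)

lemma push_tangent: "push q w \<in> tangent_space A q"
  unfolding tangent_space_def
proof (intro CollectI conjI allI impI)
  fix f show "push q w f = 0" if "\<not> smooth_fun A f"
    using that by (simp add: push_def)
next
  fix a b f g assume "smooth_fun A f" "smooth_fun A g"
  then show "push q w (\<lambda>x. a * f x + b * g x) = a * push q w f + b * push q w g"
    by (intro push_eqI smooth_fun_intros has_derivative_add has_derivative_mult_right
        push_has_derivative)
next
  fix f g assume fg: "smooth_fun A f" "smooth_fun A g"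
  then have "push q w (\<lambda>x. f x * g x) =
      f (\<phi> (inv \<phi> q)) * push q w g + push q w f * g (\<phi> (inv \<phi> q))"
    by (intro push_eqI smooth_fun_intros has_derivative_mult push_has_derivative)
  then show "push q w (\<lambda>x. f x * g x) = f q * push q w g + g q * push q w f" by simp
qed

lemma push_coord: "push q w (coord b) = w \<bullet> b"
  by (rule push_eqI[OF smooth_fun_coord])
    (simp add: coord_def bounded_linear_imp_has_derivative bounded_linear_inner_left)

lemma comps_push [simp]: "comps (push q w) = w"
  by (simp add: comps_def push_coord euclidean_representation)

text \<open>The fields \<open>\<lambda>q. push q b\<close> for \<open>b\<close> in
  \<open>Basis\<close> form a global frame; questions of smoothness become questions about
  components.\<close>

lemma push_expand: "push q w u = (\<Sum>b\<in>Basis. (w \<bullet> b) * push q b u)"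
proof (cases "smooth_fun A u")
  case True
  then have "(\<lambda>x. u (\<phi> x)) differentiable at (inv \<phi> q)"
    by (simp add: smooth_fun_iff smooth_on_differentiable)
  from frechet_derivative_eq_sum_Basis[OF this, of w] True show ?thesis
    by (simp add: push_def)
qed (simp add: push_def)

text \<open>By Hadamard's lemma a derivation is determined by its values on the coordinates.\<close>

lemma push_comps:
  assumes v: "v \<in> tangent_space A q"
  shows "push q (comps v) = v"
proof
  fix u
  show "push q (comps v) u = v u"
  proof (cases "smooth_fun A u")
    case False
    then show ?thesis using tangent_nonsmooth[OF v] by (simp add: push_def)
  next
    case True
    obtain G where G: "\<And>b. smooth_on UNIV (G b)"
      "\<And>x. u (\<phi> x) = u (\<phi> (inv \<phi> q)) + (\<Sum>b\<in>Basis. ((x - inv \<phi> q) \<bullet> b) * G b x)"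
      "\<And>b. G b (inv \<phi> q) = frechet_derivative (\<lambda>x. u (\<phi> x)) (at (inv \<phi> q)) b"
      using hadamard[OF True[unfolded smooth_fun_iff], of "inv \<phi> q"] by blast
    have sG: "smooth_fun A (\<lambda>p. G b (inv \<phi> p))" for b
      using G(1) by (simp add: smooth_fun_iff)
    \<comment> \<open>The coordinates centred at \<open>q\<close>, written as a sum so that
      additivity of \<open>v\<close> applies.\<close>
    let ?c = "\<lambda>b p. coord b p + (- coord b q)"
    have sc: "smooth_fun A (?c b)" for b by (intro smooth_fun_intros)
    have "u = (\<lambda>p. u q + (\<Sum>b\<in>Basis. ?c b p * G b (inv \<phi> p)))"
    proof
      fix p show "u p = u q + (\<Sum>b\<in>Basis. ?c b p * G b (inv \<phi> p))"
        using G(2)[of "inv \<phi> p"] by (simp add: coord_def inner_diff_left)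
    qed
    then have "v u = v (\<lambda>p. u q + (\<Sum>b\<in>Basis. ?c b p * G b (inv \<phi> p)))" by simp
    also have "\<dots> = v (\<lambda>p. u q) + v (\<lambda>p. \<Sum>b\<in>Basis. ?c b p * G b (inv \<phi> p))"
      by (intro tangent_add[OF v] smooth_fun_intros sG)
    also have "\<dots> = (\<Sum>b\<in>Basis. v (\<lambda>p. ?c b p * G b (inv \<phi> p)))"
      by (subst tangent_sum[OF v smooth_fun_mult[OF sc sG]]) (simp_all add: tangent_const[OF v])
    \<comment> \<open>Since \<open>?c b\<close> vanishes at \<open>q\<close>, the Leibniz rule
      leaves only the value of \<open>G b\<close> at \<open>inv \<phi> q\<close>, which is a partial
      derivative.\<close>
    also have "\<dots> = (\<Sum>b\<in>Basis. v (coord b) * push q b u)"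
      using True
      by (intro sum.cong refl, subst tangent_mult[OF v sc sG], subst tangent_add[OF v])
        (auto intro: smooth_fun_intros simp: tangent_const[OF v] G(3) push_def)
    also have "\<dots> = push q (comps v) u"
      by (subst push_expand) (simp add: comps_inner)
    finally show ?thesis by simp
  qed
qed

text \<open>The main tool below: identities between tangent vectors are checked on coordinates,
  where \<open>push\<close> and the connection have explicit values.\<close>

lemma tangent_eqI:
  assumes "u \<in> tangent_space A q" "v \<in> tangent_space A q"
    "\<And>b. b \<in> Basis \<Longrightarrow> u (coord b) = v (coord b)"
  shows "u = v"
  using push_comps[OF assms(1)] push_comps[OF assms(2)] assms(3) by (simp add: comps_def)

lemma vector_field_tangent: "vector_field A X \<Longrightarrow> X q \<in> tangent_space A q"
  by (simp add: vector_field_def)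

text \<open>Every tangent vector sends a non-smooth \<open>f\<close> to zero, so such an
  \<open>f\<close> gives a constant function.\<close>

lemma vector_field_smooth: "vector_field A X \<Longrightarrow> smooth_fun A (\<lambda>q. X q f)"
  using tangent_nonsmooth[OF vector_field_tangent, of X f]
  by (cases "smooth_fun A f") (simp_all add: vector_field_def smooth_fun_const)

lemma smooth_fun_push: "smooth_fun A (\<lambda>q. push q b u)"
  by (cases "smooth_fun A u")
    (simp_all add: push_def smooth_fun_const smooth_fun_iff smooth_on_frechet_derivative)

lemma vector_field_push:
  assumes "\<And>b. b \<in> Basis \<Longrightarrow> smooth_fun A (\<lambda>q. w q \<bullet> b)"
  shows "vector_field A (\<lambda>q. push q (w q))"
  unfolding vector_field_def
proof (intro conjI allI impI push_tangent)
  fix f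
  have "smooth_fun A (\<lambda>q. \<Sum>b\<in>Basis. (w q \<bullet> b) * push q b f)"
    using assms by (intro smooth_fun_intros smooth_fun_push)
  then show "smooth_fun A (\<lambda>q. push q (w q) f)"
    by (simp add: push_expand[symmetric])
qed

text \<open>The pullback of the Euclidean metric along \<open>inv \<phi>\<close>. In the global
  coordinates its matrix is the identity at every point, which is why its connection is
  flat.\<close>

definition pullback_metric :: "'m \<Rightarrow> 'm tangent \<Rightarrow> 'm tangent \<Rightarrow> real" where
  "pullback_metric q u v = comps u \<bullet> comps v"

lemma pullback_metric_eq_sum: "pullback_metric q u v = (\<Sum>b\<in>Basis. u (coord b) * v (coord b))"
  unfolding pullback_metric_def by (subst euclidean_inner) (simp add: comps_inner)

lemma pullback_metric_lincomb_left:
  "pullback_metric q (\<lambda>f. a * u f + b * v f) w = a * pullback_metric q u w + b * pullback_metric q v w"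
  by (simp add: pullback_metric_eq_sum sum.distrib sum_distrib_left algebra_simps)

lemma pullback_metric_commute: "pullback_metric q u v = pullback_metric q v u"
  by (simp add: pullback_metric_def inner_commute)

lemma pullback_metric_self_eq_0:
  assumes "v \<in> tangent_space A q" "pullback_metric q v v = 0"
  shows "v = (\<lambda>f. 0)"
proof (rule tangent_eqI[OF assms(1) zero_tangent])
  fix b :: 'a assume "b \<in> Basis"
  have "comps v = 0" using assms(2) by (simp add: pullback_metric_def)
  then show "v (coord b) = 0" using comps_inner[OF \<open>b \<in> Basis\<close>, of v] by simp
qed

lemma riemannian_metric_pullback: "riemannian_metric A pullback_metric"
  unfolding riemannian_metric_def
proof (intro conjI allI ballI impI pullback_metric_lincomb_left pullback_metric_commute)
  fix q v assume "v \<in> tangent_space A q" "v \<noteq> (\<lambda>f. 0)"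
  then have "pullback_metric q v v \<noteq> 0" using pullback_metric_self_eq_0 by blast
  then show "pullback_metric q v v > 0" by (simp add: pullback_metric_def)
next
  fix X Y assume "vector_field A X" "vector_field A Y"
  then show "smooth_fun A (\<lambda>p. pullback_metric p (X p) (Y p))"
    unfolding pullback_metric_eq_sum by (intro smooth_fun_intros vector_field_smooth)
qed

text \<open>By \<open>push_comps\<close>, \<open>v f\<close> is the derivative of
  \<open>f \<circ> \<phi>\<close> in direction \<open>comps v\<close>, hence an inner product with
  the Euclidean gradient.\<close>

lemma riemannian_gradient_pullback:
  assumes "smooth_fun A f"
  shows "riemannian_gradient A pullback_metric f q = push q (euclidean_gradient (f \<circ> \<phi>) (inv \<phi> q))"
    (is "_ = ?G")
proof -
  have G: "v f = pullback_metric q ?G v" if "v \<in> tangent_space A q" for v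
  proof -
    have "(f \<circ> \<phi>) differentiable at (inv \<phi> q)"
      using assms by (simp add: smooth_fun_iff smooth_on_differentiable o_def)
    from euclidean_gradient_inner[OF this, of "comps v"]
    have "push q (comps v) f = pullback_metric q ?G v"
      using assms by (simp add: push_def pullback_metric_def o_def inner_commute)
    then show ?thesis using push_comps[OF that] by simp
  qed
  show ?thesis
    unfolding riemannian_gradient_def
  proof (rule the_equality)
    show "?G \<in> tangent_space A q \<and> (\<forall>v\<in>tangent_space A q. v f = pullback_metric q ?G v)"
      using G push_tangent by blast
    fix w assume w: "w \<in> tangent_space A q \<and> (\<forall>v\<in>tangent_space A q. v f = pullback_metric q w v)"
    show "w = ?G"
    proof (rule tangent_eqI[OF _ push_tangent])
      show "w \<in> tangent_space A q" using w by blast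
      fix b :: 'a assume "b \<in> Basis"
      \<comment> \<open>Testing against the orthonormal frame reads off the components of
        \<open>w\<close>.\<close>
      have "pullback_metric q w (push q b) = pullback_metric q ?G (push q b)"
        using w G push_tangent by metis
      then show "w (coord b) = ?G (coord b)"
        using \<open>b \<in> Basis\<close> by (simp add: pullback_metric_def comps_inner push_coord)
    qed
  qed
qed

lemma push_zero: "push q 0 = (\<lambda>u. 0)"
  by (rule ext, subst push_expand) simp

lemma push_scaleR: "push q (a *\<^sub>R w) u = a * push q w u"
  by (subst (1 2) push_expand) (simp add: sum_distrib_left mult.assoc)

section \<open>The flat connection\<close>

text \<open>The connection whose Christoffel symbols vanish in the global coordinates; it is the
  candidate behind the \<open>SOME\<close> in \<open>levi_civita\<close>.\<close>

definition flat_connection :: "'m vfield \<Rightarrow> 'm vfield \<Rightarrow> 'm vfield" where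
  "flat_connection X Y q = push q (\<Sum>b\<in>Basis. X q (\<lambda>p. Y p (coord b)) *\<^sub>R b)"

lemma flat_connection_coord:
  "b \<in> Basis \<Longrightarrow> flat_connection X Y q (coord b) = X q (\<lambda>p. Y p (coord b))"
  by (simp add: flat_connection_def push_coord)

lemma flat_connection_tangent: "flat_connection X Y q \<in> tangent_space A q"
  unfolding flat_connection_def by (rule push_tangent)

lemma flat_connection_eqI:
  assumes "\<And>p. T p \<in> tangent_space A p"
    "\<And>p b. b \<in> Basis \<Longrightarrow> X p (\<lambda>q. Y q (coord b)) = T p (coord b)"
  shows "flat_connection X Y = T"
  by (intro ext[of _ T] tangent_eqI[OF flat_connection_tangent assms(1)])
    (simp add: flat_connection_coord assms(2))

text \<open>In the Leibniz rule the mixed terms \<open>X f * Y g + X g * Y f\<close> are symmetric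
  in the two fields and cancel. Membership allows \<open>tangent_eqI\<close> to be used for the
  torsion identity.\<close>

lemma lie_bracket_tangent:
  assumes X: "vector_field A X" and Y: "vector_field A Y"
  shows "lie_bracket X Y p \<in> tangent_space A p"
proof -
  note XT = vector_field_tangent[OF X] and YT = vector_field_tangent[OF Y]
    and XS = vector_field_smooth[OF X] and YS = vector_field_smooth[OF Y]
  show ?thesis
    unfolding tangent_space_def
  proof (intro CollectI conjI allI impI)
    fix f assume "\<not> smooth_fun A f"
    then show "lie_bracket X Y p f = 0"
      using tangent_nonsmooth[OF XT] tangent_nonsmooth[OF YT]
      by (simp add: lie_bracket_def tangent_const[OF XT] tangent_const[OF YT])
  next
    fix a b f g assume fg: "smooth_fun A f" "smooth_fun A g"
    then show "lie_bracket X Y p (\<lambda>x. a * f x + b * g x) =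
        a * lie_bracket X Y p f + b * lie_bracket X Y p g"
      by (simp add: lie_bracket_def tangent_lincomb[OF XT] tangent_lincomb[OF YT] XS YS
          algebra_simps)
  next
    fix f g assume fg: "smooth_fun A f" "smooth_fun A g"
    then show "lie_bracket X Y p (\<lambda>x. f x * g x) =
        f p * lie_bracket X Y p g + g p * lie_bracket X Y p f"
      by (simp add: lie_bracket_def tangent_mult[OF XT] tangent_mult[OF YT] XS YS
          tangent_add[OF XT] tangent_add[OF YT] smooth_fun_mult algebra_simps)
  qed
qed

text \<open>On coordinates each axiom becomes linearity or the Leibniz rule of the derivation
  \<open>X p\<close>, applied to component functions.\<close>

lemma affine_connection_flat: "affine_connection A flat_connection"
  unfolding affine_connection_def
proof (intro conjI allI impI)
  fix X Y assume X: "vector_field A X" and Y: "vector_field A Y"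
  show "vector_field A (flat_connection X Y)"
    unfolding flat_connection_def [abs_def]
    by (rule vector_field_push) (simp add: vector_field_smooth[OF X])
next
  fix f g X Y Z
  show "flat_connection (\<lambda>p u. f p * X p u + g p * Y p u) Z =
      (\<lambda>p u. f p * flat_connection X Z p u + g p * flat_connection Y Z p u)"
    by (intro flat_connection_eqI flat_connection_tangent lincomb_tangent)
      (simp add: flat_connection_coord)
next
  fix a b X Y Z
  assume X: "vector_field A X" and Y: "vector_field A Y" and Z: "vector_field A Z"
  show "flat_connection X (\<lambda>p u. a * Y p u + b * Z p u) =
      (\<lambda>p u. a * flat_connection X Y p u + b * flat_connection X Z p u)"
    by (intro flat_connection_eqI flat_connection_tangent lincomb_tangent)
      (simp add: flat_connection_coord tangent_lincomb[OF vector_field_tangent[OF X]]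
        vector_field_smooth Y Z)
next
  fix f X Y assume f: "smooth_fun A f" and X: "vector_field A X" and Y: "vector_field A Y"
  show "flat_connection X (\<lambda>p u. f p * Y p u) =
      (\<lambda>p u. f p * flat_connection X Y p u + X p f * Y p u)"
    by (intro flat_connection_eqI flat_connection_tangent lincomb_tangent vector_field_tangent Y)
      (simp add: flat_connection_coord tangent_mult[OF vector_field_tangent[OF X]]
        vector_field_smooth Y f)
qed

text \<open>Both sides of the torsion identity are derivations, so it suffices to compare them on the
  coordinates; the symmetry of second derivatives is not needed.\<close>

lemma is_levi_civita_flat: "is_levi_civita A pullback_metric flat_connection"
  unfolding is_levi_civita_def
proof (intro conjI allI impI affine_connection_flat)
  fix X Y assume X: "vector_field A X" and Y: "vector_field A Y"
  show "(\<lambda>p f. flat_connection X Y p f - flat_connection Y X p f) = lie_bracket X Y"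
  proof
    fix p
    show "(\<lambda>f. flat_connection X Y p f - flat_connection Y X p f) = lie_bracket X Y p"
    proof (rule tangent_eqI)
      show "(\<lambda>f. flat_connection X Y p f - flat_connection Y X p f) \<in> tangent_space A p"
        using lincomb_tangent[OF flat_connection_tangent[of X Y p]
            flat_connection_tangent[of Y X p], of 1 "-1"] by simp
      show "lie_bracket X Y p \<in> tangent_space A p" by (rule lie_bracket_tangent[OF X Y])
    qed (simp add: flat_connection_coord lie_bracket_def)
  qed
next
  fix X Y Z p
  assume X: "vector_field A X" and Y: "vector_field A Y" and Z: "vector_field A Z"
  note XT = vector_field_tangent[OF X]
  have "X p (\<lambda>q. pullback_metric q (Y q) (Z q)) =
      (\<Sum>b\<in>Basis. X p (\<lambda>q. Y q (coord b) * Z q (coord b)))"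
    unfolding pullback_metric_eq_sum
    by (intro tangent_sum[OF XT] smooth_fun_intros vector_field_smooth Y Z)
  also have "\<dots> = (\<Sum>b\<in>Basis. flat_connection X Y p (coord b) * Z p (coord b)) +
      (\<Sum>b\<in>Basis. Y p (coord b) * flat_connection X Z p (coord b))"
    by (simp add: tangent_mult[OF XT] vector_field_smooth Y Z flat_connection_coord
        mult.commute sum.distrib cong: sum.cong)
  finally show "X p (\<lambda>q. pullback_metric q (Y q) (Z q)) =
      pullback_metric p (flat_connection X Y p) (Z p) +
      pullback_metric p (Y p) (flat_connection X Z p)"
    by (simp add: pullback_metric_eq_sum)
qed

text \<open>The difference of two Levi-Civita connections, lowered by the metric, is symmetric in its
  first two arguments and antisymmetric in the last two, hence zero.\<close>

lemma is_levi_civita_unique: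
  assumes D: "is_levi_civita A pullback_metric D" and D': "is_levi_civita A pullback_metric D'"
    and X: "vector_field A X" and Y: "vector_field A Y"
  shows "D X Y = D' X Y"
proof
  fix p
  let ?s = "\<lambda>X Y. comps (D X Y p) - comps (D' X Y p)"
  have vf: "vector_field A (D X Y)" "vector_field A (D' X Y)"
    using D D' X Y by (auto simp: is_levi_civita_def affine_connection_def)
  have sym: "?s X Y = ?s Y X" if X: "vector_field A X" and Y: "vector_field A Y" for X Y
  proof -
    have "(\<lambda>p f. D X Y p f - D Y X p f) = (\<lambda>p f. D' X Y p f - D' Y X p f)"
      using D D' X Y by (simp add: is_levi_civita_def)
    then have "D X Y p f - D Y X p f = D' X Y p f - D' Y X p f" for f
      by (simp only: fun_eq_iff)
    then have "D X Y p f - D' X Y p f = D Y X p f - D' Y X p f" for f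
      by (simp add: algebra_simps)
    then show ?thesis
      by (simp add: comps_def sum_subtractf[symmetric] scaleR_diff_left[symmetric])
  qed
  have antisym: "?s X Y \<bullet> comps (Z p) = - (?s X Z \<bullet> comps (Y p))"
    if "vector_field A X" "vector_field A Y" "vector_field A Z" for X Y Z
  proof -
    have "X p (\<lambda>q. pullback_metric q (Y q) (Z q)) =
        pullback_metric p (D X Y p) (Z p) + pullback_metric p (Y p) (D X Z p)"
      using D that by (simp add: is_levi_civita_def)
    moreover have "X p (\<lambda>q. pullback_metric q (Y q) (Z q)) =
        pullback_metric p (D' X Y p) (Z p) + pullback_metric p (Y p) (D' X Z p)"
      using D' that by (simp add: is_levi_civita_def)
    ultimately have "pullback_metric p (D X Y p) (Z p) + pullback_metric p (Y p) (D X Z p) =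
        pullback_metric p (D' X Y p) (Z p) + pullback_metric p (Y p) (D' X Z p)"
      by simp
    then show ?thesis
      by (simp add: pullback_metric_def inner_diff_left inner_commute[of "comps (Y p)"] algebra_simps)
  qed
  \<comment> \<open>Alternating the two symmetries three times returns to the same expression with
    the opposite sign.\<close>
  have zero: "?s X Y \<bullet> comps (Z p) = 0" if Z: "vector_field A Z" for Z
    using antisym[OF X Y Z] sym[OF X Z] antisym[OF Z X Y] sym[OF Z Y] antisym[OF Y Z X] sym[OF Y X]
    by simp
  \<comment> \<open>The vector \<open>?s X Y\<close> is itself a difference of values of vector
    fields, namely \<open>D X Y\<close> and \<open>D' X Y\<close>.\<close>
  have "?s X Y \<bullet> ?s X Y = 0"
    using zero[OF vf(1)] zero[OF vf(2)] by (simp add: inner_diff_right)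
  then have "comps (D X Y p) = comps (D' X Y p)" by simp
  then show "D X Y p = D' X Y p"
    using push_comps[OF vector_field_tangent[OF vf(1)]] push_comps[OF vector_field_tangent[OF vf(2)]]
    by metis
qed

text \<open>Existence makes the \<open>SOME\<close> a Levi-Civita connection, and uniqueness
  identifies its values on smooth vector fields.\<close>

lemma levi_civita_eq_flat:
  assumes "vector_field A X" "vector_field A Y"
  shows "levi_civita A pullback_metric X Y = flat_connection X Y"
proof -
  have "is_levi_civita A pullback_metric (levi_civita A pullback_metric)"
    unfolding levi_civita_def by (rule someI[of _ flat_connection], rule is_levi_civita_flat)
  then show ?thesis
    using is_levi_civita_flat assms by (rule is_levi_civita_unique)
qed

section \<open>Covariant derivatives along curves\<close>

definition flat_derivative_along ::
    "(real \<Rightarrow> 'm) \<Rightarrow> (real \<Rightarrow> 'm tangent) \<Rightarrow> real \<Rightarrow> 'm tangent" where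
  "flat_derivative_along \<gamma> V t = push (\<gamma> t) (\<Sum>b\<in>Basis. deriv (\<lambda>s. V s (coord b)) t *\<^sub>R b)"

lemma flat_derivative_along_coord:
  "b \<in> Basis \<Longrightarrow> flat_derivative_along \<gamma> V t (coord b) = deriv (\<lambda>s. V s (coord b)) t"
  by (simp add: flat_derivative_along_def push_coord)

text \<open>The chain rule for \<open>u \<circ> \<gamma>\<close>, factored through the global chart
  as \<open>(u \<circ> \<phi>) \<circ> (inv \<phi> \<circ> \<gamma>)\<close>.\<close>

lemma velocity_eq_push:
  assumes "((\<lambda>t. inv \<phi> (\<gamma> t)) has_vector_derivative w) (at t)"
  shows "velocity A \<gamma> t = push (\<gamma> t) w"
proof
  fix u
  show "velocity A \<gamma> t u = push (\<gamma> t) w u"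
  proof (cases "smooth_fun A u")
    case True
    have "((\<lambda>s. u (\<phi> (inv \<phi> (\<gamma> s)))) has_derivative (\<lambda>s. push (\<gamma> t) (s *\<^sub>R w) u)) (at t)"
      using assms push_has_derivative[OF True] unfolding has_vector_derivative_def
      by (rule has_derivative_compose)
    then have "((u \<circ> \<gamma>) has_real_derivative push (\<gamma> t) w u) (at t)"
      by (simp add: push_scaleR has_field_derivative_def o_def mult.commute[of _ "push (\<gamma> t) w u"])
    then show ?thesis using True by (simp add: velocity_def DERIV_imp_deriv)
  qed (simp add: velocity_def push_def)
qed

end

text \<open>Smoothness of the curve is stated in the global chart; for open \<open>I\<close>,
  \<open>smooth_map_on_iff\<close> translates it into \<open>smooth_map_on\<close>.\<close>

locale smooth_curve = euclidean_diffeo A \<phi>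
  for A :: "('m::{t2_space,second_countable_topology}, 'e::euclidean_space) atlas"
    and \<phi> :: "'a::euclidean_space \<Rightarrow> 'm" +
  fixes I :: "real set" and \<gamma> :: "real \<Rightarrow> 'm"
  assumes open_I: "open I"
    and smooth_curve: "smooth_on I (\<lambda>t. inv \<phi> (\<gamma> t))"
begin

lemma smooth_along:
  assumes "smooth_fun A u"
  shows "smooth_on I (\<lambda>t. u (\<gamma> t))"
  using smooth_on_compose[OF open_I open_UNIV assms[unfolded smooth_fun_iff] smooth_curve]
  by simp

lemma along_tangent: "vector_field_along A I \<gamma> V \<Longrightarrow> t \<in> I \<Longrightarrow> V t \<in> tangent_space A (\<gamma> t)"
  by (simp add: vector_field_along_def)

lemma along_smooth: "vector_field_along A I \<gamma> V \<Longrightarrow> smooth_fun A u \<Longrightarrow> smooth_on I (\<lambda>t. V t u)"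
  by (simp add: vector_field_along_def)

lemma along_has_derivative:
  assumes "vector_field_along A I \<gamma> V" "t \<in> I"
  shows "((\<lambda>s. V s (coord b)) has_real_derivative deriv (\<lambda>s. V s (coord b)) t) (at t)"
  by (rule smooth_on_has_real_derivative[OF along_smooth[OF assms(1) smooth_fun_coord] assms(2)])

lemma along_lincomb:
  assumes "vector_field_along A I \<gamma> V" "vector_field_along A I \<gamma> W"
  shows "vector_field_along A I \<gamma> (\<lambda>s u. a * V s u + b * W s u)"
  unfolding vector_field_along_def
  by (intro conjI ballI allI impI lincomb_tangent smooth_on_add smooth_on_mult smooth_on_const
      open_I along_tangent along_smooth assms)

lemma along_scale:
  assumes "smooth_on I f" "vector_field_along A I \<gamma> V"
  shows "vector_field_along A I \<gamma> (\<lambda>s u. f s * V s u)"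
  unfolding vector_field_along_def
  by (intro conjI ballI allI impI scale_tangent smooth_on_mult open_I along_tangent along_smooth
      assms)

lemma along_zero: "vector_field_along A I \<gamma> (\<lambda>s u. 0)"
  by (simp add: vector_field_along_def zero_tangent smooth_on_const open_I)

lemma along_push: "vector_field_along A I \<gamma> (\<lambda>s. push (\<gamma> s) b)"
  by (simp add: vector_field_along_def push_tangent smooth_along[OF smooth_fun_push])

lemma along_flat_derivative:
  assumes "vector_field_along A I \<gamma> V"
  shows "vector_field_along A I \<gamma> (flat_derivative_along \<gamma> V)"
  unfolding vector_field_along_def
proof (intro conjI ballI allI impI)
  fix t show "flat_derivative_along \<gamma> V t \<in> tangent_space A (\<gamma> t)"
    unfolding flat_derivative_along_def by (rule push_tangent)
next
  fix u assume "smooth_fun A u"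
  have "smooth_on I (\<lambda>t. \<Sum>b\<in>Basis. deriv (\<lambda>s. V s (coord b)) t * push (\<gamma> t) b u)"
    by (intro smooth_on_sum smooth_on_mult smooth_on_deriv open_I along_smooth[OF assms]
        smooth_fun_coord smooth_along smooth_fun_push)
  moreover have "flat_derivative_along \<gamma> V t u =
      (\<Sum>b\<in>Basis. deriv (\<lambda>s. V s (coord b)) t * push (\<gamma> t) b u)" for t
    unfolding flat_derivative_along_def by (subst push_expand) simp
  ultimately show "smooth_on I (\<lambda>t. flat_derivative_along \<gamma> V t u)" by simp
qed

text \<open>Supplies the witness for the \<open>SOME\<close> in
  \<open>covariant_derivative_along\<close>. Agreement with the connection holds since
  \<open>velocity\<close>, applied to a component of \<open>Y\<close>, is the derivative of that
  component along \<open>\<gamma>\<close>.\<close>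

lemma is_covariant_derivative_along_flat:
  "is_covariant_derivative_along A (levi_civita A pullback_metric) I \<gamma> (flat_derivative_along \<gamma>)"
  unfolding is_covariant_derivative_along_def
proof (intro conjI allI impI ballI along_flat_derivative)
  fix a b V W t
  assume V: "vector_field_along A I \<gamma> V" and W: "vector_field_along A I \<gamma> W" and t: "t \<in> I"
  note dV = along_has_derivative[OF V t] and dW = along_has_derivative[OF W t]
  show "flat_derivative_along \<gamma> (\<lambda>s u. a * V s u + b * W s u) t =
      (\<lambda>u. a * flat_derivative_along \<gamma> V t u + b * flat_derivative_along \<gamma> W t u)"
    by (rule tangent_eqI[OF along_tangent[OF along_flat_derivative[OF along_lincomb[OF V W]] t]
          lincomb_tangent[OF along_tangent[OF along_flat_derivative[OF V] t]
            along_tangent[OF along_flat_derivative[OF W] t]]])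
      (auto simp: flat_derivative_along_coord intro!: DERIV_imp_deriv DERIV_add DERIV_cmult dV dW)
next
  fix f :: "real \<Rightarrow> real" and V t
  assume f: "smooth_on I f" and V: "vector_field_along A I \<gamma> V" and t: "t \<in> I"
  note dV = along_has_derivative[OF V t] and df = smooth_on_has_real_derivative[OF f t]
  show "flat_derivative_along \<gamma> (\<lambda>s u. f s * V s u) t =
      (\<lambda>u. deriv f t * V t u + f t * flat_derivative_along \<gamma> V t u)"
    by (rule tangent_eqI[OF along_tangent[OF along_flat_derivative[OF along_scale[OF f V]] t]
          lincomb_tangent[OF along_tangent[OF V t]
            along_tangent[OF along_flat_derivative[OF V] t]]])
      (auto simp: flat_derivative_along_coord
        intro!: DERIV_imp_deriv DERIV_mult'[OF df dV, THEN DERIV_cong])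
next
  fix X Y t
  assume X: "vector_field A X" and Y: "vector_field A Y" and t: "t \<in> I"
    and v: "X (\<gamma> t) = velocity A \<gamma> t"
  show "flat_derivative_along \<gamma> (Y \<circ> \<gamma>) t = levi_civita A pullback_metric X Y (\<gamma> t)"
    unfolding levi_civita_eq_flat[OF X Y]
  proof (rule tangent_eqI[OF _ flat_connection_tangent])
    show "flat_derivative_along \<gamma> (Y \<circ> \<gamma>) t \<in> tangent_space A (\<gamma> t)"
      unfolding flat_derivative_along_def by (rule push_tangent)
    fix b :: 'a assume "b \<in> Basis"
    then show "flat_derivative_along \<gamma> (Y \<circ> \<gamma>) t (coord b) = flat_connection X Y (\<gamma> t) (coord b)"
      by (simp add: flat_derivative_along_coord flat_connection_coord v velocity_def
          vector_field_smooth[OF Y] o_def)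
  qed
qed

text \<open>Locality: multiplying by the indicator function of the complement of \<open>I\<close>, which is smooth
  on \<open>I\<close>, does not change a field that vanishes on \<open>I\<close>.\<close>

lemma covariant_derivative_zero:
  assumes D: "is_covariant_derivative_along A D I \<gamma> Dt"
    and Z: "vector_field_along A I \<gamma> Z" "\<And>s. s \<in> I \<Longrightarrow> Z s = (\<lambda>u. 0)" and t: "t \<in> I"
  shows "Dt Z t = (\<lambda>u. 0)"
proof -
  let ?f = "\<lambda>s. if s \<in> I then 0 else 1 :: real"
  have "smooth_on I ?f"
    by (rule smooth_on_cong[OF open_I _ smooth_on_const[OF open_I, of 0]]) simp
  then have "Dt (\<lambda>s u. ?f s * Z s u) t = (\<lambda>u. deriv ?f t * Z t u + ?f t * Dt Z t u)"
    using D Z(1) t unfolding is_covariant_derivative_along_def by blast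
  moreover have "(\<lambda>s u. ?f s * Z s u) = Z"
    using Z(2) by (auto intro!: ext)
  ultimately show ?thesis using t Z(2) by simp
qed

text \<open>Expand \<open>V\<close> on \<open>I\<close> in the constant frame, which is parallel.\<close>

lemma is_covariant_derivative_along_unique:
  assumes D: "is_covariant_derivative_along A (levi_civita A pullback_metric) I \<gamma> Dt"
    and V: "vector_field_along A I \<gamma> V" and t: "t \<in> I"
    and v: "velocity A \<gamma> t \<in> tangent_space A (\<gamma> t)"
  shows "Dt V t = flat_derivative_along \<gamma> V t"
proof -
  have lin: "Dt (\<lambda>s u. a * V s u + b * W s u) t = (\<lambda>u. a * Dt V t u + b * Dt W t u)"
    if "vector_field_along A I \<gamma> V" "vector_field_along A I \<gamma> W" for a b V W
    using D t that unfolding is_covariant_derivative_along_def by blast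
  have leibniz: "Dt (\<lambda>s u. f s * V s u) t = (\<lambda>u. deriv f t * V t u + f t * Dt V t u)"
    if "smooth_on I f" "vector_field_along A I \<gamma> V" for f V
    using D t that unfolding is_covariant_derivative_along_def by blast
  have frame: "Dt (\<lambda>s. push (\<gamma> s) b) t = (\<lambda>u. 0)" for b
  proof -
    \<comment> \<open>Constant components extend the velocity at \<open>t\<close> to a vector field;
      those of \<open>?Y\<close> are constant too, so differentiating them gives zero.\<close>
    let ?X = "\<lambda>q. push q (comps (velocity A \<gamma> t))" and ?Y = "\<lambda>q. push q b"
    have vf: "vector_field A ?X" "vector_field A ?Y"
      by (auto intro!: vector_field_push smooth_fun_const)
    have "Dt (?Y \<circ> \<gamma>) t = levi_civita A pullback_metric ?X ?Y (\<gamma> t)"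
      using D t vf push_comps[OF v] unfolding is_covariant_derivative_along_def by blast
    also have "\<dots> = flat_connection ?X ?Y (\<gamma> t)"
      by (simp add: levi_civita_eq_flat vf)
    also have "\<dots> = (\<lambda>u. 0)"
      by (simp add: flat_connection_def push_coord tangent_const[OF push_tangent] push_zero)
    finally show ?thesis by (simp add: o_def)
  qed
  \<comment> \<open>Linearity of \<open>Dt\<close> is given for two fields only, and only for fields
    along \<open>\<gamma>\<close>; hence an induction on \<open>F\<close> that proves both claims
    together.\<close>
  let ?W = "\<lambda>F s u. \<Sum>b\<in>F. V s (coord b) * push (\<gamma> s) b u"
  have W: "vector_field_along A I \<gamma> (?W F) \<and>
      Dt (?W F) t = (\<lambda>u. \<Sum>b\<in>F. deriv (\<lambda>s. V s (coord b)) t * push (\<gamma> t) b u)"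
    if "finite F" for F
    using that
  proof (induction F rule: finite_induct)
    case empty
    show ?case using along_zero covariant_derivative_zero[OF D along_zero _ t] by simp
  next
    case (insert b F)
    let ?U = "\<lambda>s u. V s (coord b) * push (\<gamma> s) b u"
    have sV: "smooth_on I (\<lambda>s. V s (coord b))"
      by (rule along_smooth[OF V smooth_fun_coord])
    have U: "vector_field_along A I \<gamma> ?U" by (rule along_scale[OF sV along_push])
    have "?W (insert b F) = (\<lambda>s u. 1 * ?U s u + 1 * ?W F s u)"
      using insert.hyps by simp
    then show ?case
      using insert along_lincomb[OF U, of "?W F" 1 1] lin[OF U, of "?W F" 1 1]
        leibniz[OF sV along_push] frame by simp
  qed
  note WB = W[OF finite_Basis]
  \<comment> \<open>The expansion represents \<open>V\<close> on \<open>I\<close> only, since the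
    values of \<open>V\<close> elsewhere are arbitrary. Locality of \<open>Dt\<close> bridges this
    gap.\<close>
  let ?Z = "\<lambda>s u. 1 * V s u + (-1) * ?W Basis s u"
  have Z: "vector_field_along A I \<gamma> ?Z" by (rule along_lincomb[OF V]) (use WB in blast)
  have Z0: "?Z s = (\<lambda>u. 0)" if "s \<in> I" for s
  proof
    fix u
    have "V s u = push (\<gamma> s) (comps (V s)) u" by (simp add: push_comps[OF along_tangent[OF V that]])
    also have "\<dots> = ?W Basis s u" by (subst push_expand) (simp add: comps_inner)
    finally show "?Z s u = 0" by simp
  qed
  have "Dt ?Z t = (\<lambda>u. 1 * Dt V t u + (-1) * Dt (?W Basis) t u)"
    using lin[OF V] WB by blast
  then have "(\<lambda>u. 1 * Dt V t u + (-1) * Dt (?W Basis) t u) = (\<lambda>u. 0)"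
    using covariant_derivative_zero[OF D Z Z0 t] by (simp only:)
  then have "1 * Dt V t u + (-1) * Dt (?W Basis) t u = 0" for u
    by (rule fun_cong)
  then have "Dt V t u = Dt (?W Basis) t u" for u by simp
  moreover have "Dt (?W Basis) t u = flat_derivative_along \<gamma> V t u" for u
    using WB unfolding flat_derivative_along_def by (subst push_expand) simp
  ultimately show ?thesis by (intro ext) simp
qed

lemma along_velocity: "vector_field_along A I \<gamma> (velocity A \<gamma>)"
  unfolding vector_field_along_def
proof (intro conjI ballI allI impI)
  fix t assume "t \<in> I"
  then obtain w where "((\<lambda>t. inv \<phi> (\<gamma> t)) has_vector_derivative w) (at t)"
    using smooth_on_differentiable[OF smooth_curve] vector_derivative_works by blast
  then show "velocity A \<gamma> t \<in> tangent_space A (\<gamma> t)"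
    by (simp add: velocity_eq_push push_tangent)
next
  fix u assume "smooth_fun A u"
  then show "smooth_on I (\<lambda>t. velocity A \<gamma> t u)"
    using smooth_on_deriv[OF open_I smooth_along] by (simp add: velocity_def o_def)
qed

lemma covariant_derivative_along_eq_flat:
  assumes V: "vector_field_along A I \<gamma> V" and t: "t \<in> I"
  shows "covariant_derivative_along A (levi_civita A pullback_metric) I \<gamma> V t =
    flat_derivative_along \<gamma> V t"
proof -
  have "is_covariant_derivative_along A (levi_civita A pullback_metric) I \<gamma>
      (covariant_derivative_along A (levi_civita A pullback_metric) I \<gamma>)"
    unfolding covariant_derivative_along_def
    by (rule someI[of _ "flat_derivative_along \<gamma>"], rule is_covariant_derivative_along_flat)
  from is_covariant_derivative_along_unique[OF this V t along_tangent[OF along_velocity t]]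
  show ?thesis .
qed

end

context euclidean_diffeo
begin

section \<open>Geodesics and the exponential map\<close>

text \<open>Replaces the operators chosen by \<open>SOME\<close> with explicit derivatives of
  components. If \<open>I\<close> is not open or the curve not smooth, both sides are false.\<close>

lemma geodesic_iff:
  "geodesic A pullback_metric I \<gamma> \<longleftrightarrow>
    open I \<and> is_interval I \<and> smooth_on I (\<lambda>t. inv \<phi> (\<gamma> t)) \<and>
    (\<forall>t\<in>I. flat_derivative_along \<gamma> (velocity A \<gamma>) t = (\<lambda>u. 0))"
proof (cases "open I \<and> smooth_on I (\<lambda>t. inv \<phi> (\<gamma> t))")
  case True
  then interpret smooth_curve A \<phi> I \<gamma> by unfold_locales auto
  show ?thesis
    unfolding geodesic_def
    using True covariant_derivative_along_eq_flat[OF along_velocity] smooth_map_on_iff[of I \<gamma>]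
    by auto
next
  case False
  then show ?thesis
    unfolding geodesic_def using smooth_map_on_iff[of I \<gamma>] by blast
qed

text \<open>Each coordinate has zero second derivative on the interval \<open>I\<close>, so its
  first derivative is constant and the mean value theorem on \<open>[0, 1]\<close> gives the
  increment. This is the uniqueness behind the \<open>THE\<close> in
  \<open>riemannian_exp\<close>.\<close>

lemma geodesic_endpoint:
  assumes g: "geodesic A pullback_metric I \<gamma>" and I: "0 \<in> I" "1 \<in> I"
  shows "\<gamma> 1 = \<phi> (inv \<phi> (\<gamma> 0) + comps (velocity A \<gamma> 0))"
proof -
  have I_open: "open I" and I_interval: "is_interval I"
    and sc: "smooth_on I (\<lambda>t. inv \<phi> (\<gamma> t))"
    and flat: "\<And>t. t \<in> I \<Longrightarrow> flat_derivative_along \<gamma> (velocity A \<gamma>) t = (\<lambda>u. 0)"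
    using g by (simp_all add: geodesic_iff)
  have "inv \<phi> (\<gamma> 1) = inv \<phi> (\<gamma> 0) + comps (velocity A \<gamma> 0)"
  proof (rule euclidean_eqI)
    fix b :: 'a assume b: "b \<in> Basis"
    let ?g = "\<lambda>t. inv \<phi> (\<gamma> t) \<bullet> b"
    have sg: "smooth_on I ?g"
      by (rule smooth_on_bounded_linear[OF I_open bounded_linear_inner_left sc])
    have vel: "velocity A \<gamma> s (coord b) = deriv ?g s" for s
      by (simp add: velocity_def smooth_fun_coord o_def coord_def)
    have "(deriv ?g has_real_derivative 0) (at t within I)" if "t \<in> I" for t
    proof -
      have "deriv (deriv ?g) t = 0"
        using flat_derivative_along_coord[OF b, of \<gamma> "velocity A \<gamma>" t] by (simp add: flat[OF that] vel)
      then show ?thesis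
        using smooth_on_has_real_derivative[OF smooth_on_deriv[OF I_open sg] that]
        by (simp add: has_field_derivative_at_within)
    qed
    then have "\<exists>c. \<forall>t\<in>I. deriv ?g t = c"
      by (rule has_field_derivative_zero_constant[OF is_interval_convex[OF I_interval]])
    then obtain c where c: "\<And>t. t \<in> I \<Longrightarrow> deriv ?g t = c" by blast
    have sub: "t \<in> I" if "0 \<le> t" "t \<le> 1" for t
      using I_interval I that unfolding is_interval_1 by blast
    have "\<exists>z::real. z > 0 \<and> z < 1 \<and> ?g 1 - ?g 0 = (1 - 0) * deriv ?g z"
      by (rule MVT2) (simp_all add: smooth_on_has_real_derivative[OF sg] sub)
    then have "?g 1 - ?g 0 = deriv ?g 0" using c sub I by force
    then show "inv \<phi> (\<gamma> 1) \<bullet> b = (inv \<phi> (\<gamma> 0) + comps (velocity A \<gamma> 0)) \<bullet> b"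
      by (simp add: inner_add_left comps_inner[OF b] vel)
  qed
  then have "\<phi> (inv \<phi> (\<gamma> 1)) = \<phi> (inv \<phi> (\<gamma> 0) + comps (velocity A \<gamma> 0))"
    by (rule arg_cong)
  then show ?thesis by simp
qed

lemma velocity_line: "velocity A (\<lambda>t. \<phi> (y + t *\<^sub>R w)) s = push (\<phi> (y + s *\<^sub>R w)) w"
proof (rule velocity_eq_push)
  have "((\<lambda>t. y + t *\<^sub>R w) has_vector_derivative 0 + 1 *\<^sub>R w) (at s)"
    unfolding has_vector_derivative_def
    by (intro has_derivative_eq_rhs[OF has_derivative_add[OF has_derivative_const
            has_derivative_scaleR_left[OF has_derivative_ident]]]) simp
  then show "((\<lambda>t. inv \<phi> (\<phi> (y + t *\<^sub>R w))) has_vector_derivative w) (at s)" by simp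
qed

text \<open>The velocity has constant components \<open>w\<close>. These curves run for all time, so
  the exponential map is defined at every tangent vector.\<close>

lemma geodesic_line: "geodesic A pullback_metric UNIV (\<lambda>t. \<phi> (y + t *\<^sub>R w))"
  unfolding geodesic_iff
proof (intro conjI ballI)
  show "smooth_on UNIV (\<lambda>t. inv \<phi> (\<phi> (y + t *\<^sub>R w)))"
    by (simp add: smooth_on_add smooth_on_const smooth_on_ident
        smooth_on_bounded_linear[OF open_UNIV bounded_linear_scaleR_left])
  fix t
  show "flat_derivative_along (\<lambda>t. \<phi> (y + t *\<^sub>R w)) (velocity A (\<lambda>t. \<phi> (y + t *\<^sub>R w))) t = (\<lambda>u. 0)"
    by (simp add: flat_derivative_along_def velocity_line push_coord push_zero)
qed simp_all

lemma geodesic_from: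
  "\<exists>I \<gamma>. geodesic A pullback_metric I \<gamma> \<and> 0 \<in> I \<and> 1 \<in> I \<and> \<gamma> 0 = q \<and> velocity A \<gamma> 0 = push q w"
proof (intro exI conjI)
  show "geodesic A pullback_metric UNIV (\<lambda>t. \<phi> (inv \<phi> q + t *\<^sub>R w))"
    by (rule geodesic_line)
  show "velocity A (\<lambda>t. \<phi> (inv \<phi> q + t *\<^sub>R w)) 0 = push q w"
    by (simp add: velocity_line)
qed simp_all

lemma riemannian_exp_domain_pullback:
  "push q w \<in> riemannian_exp_domain A pullback_metric q"
  unfolding riemannian_exp_domain_def using push_tangent geodesic_from by blast

lemma riemannian_exp_pullback:
  "riemannian_exp A pullback_metric q (push q w) = \<phi> (inv \<phi> q + w)"
  unfolding riemannian_exp_def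
proof (rule the_equality)
  obtain I \<gamma> where g: "geodesic A pullback_metric I \<gamma>" "0 \<in> I" "1 \<in> I" "\<gamma> 0 = q"
    "velocity A \<gamma> 0 = push q w"
    using geodesic_from[of q w] by blast
  moreover have "\<phi> (inv \<phi> q + w) = \<gamma> 1"
    using geodesic_endpoint[OF g(1-3)] g(4,5) by simp
  ultimately show "\<exists>I \<gamma>. geodesic A pullback_metric I \<gamma> \<and> 0 \<in> I \<and> 1 \<in> I \<and> \<gamma> 0 = q \<and>
      velocity A \<gamma> 0 = push q w \<and> \<phi> (inv \<phi> q + w) = \<gamma> 1"
    by (intro exI conjI)
next
  fix z
  assume "\<exists>I \<gamma>. geodesic A pullback_metric I \<gamma> \<and> 0 \<in> I \<and> 1 \<in> I \<and> \<gamma> 0 = q \<and>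
      velocity A \<gamma> 0 = push q w \<and> z = \<gamma> 1"
  then obtain I \<gamma> where g: "geodesic A pullback_metric I \<gamma>" "0 \<in> I" "1 \<in> I" "\<gamma> 0 = q"
    "velocity A \<gamma> 0 = push q w" "z = \<gamma> 1"
    by blast
  show "z = \<phi> (inv \<phi> q + w)"
    using geodesic_endpoint[OF g(1-3)] g(4-6) by simp
qed

end

section \<open>Equivalence of the two iterations\<close>

theorem theorem4p3:
  fixes A :: "('m::{t2_space,second_countable_topology}, 'e::euclidean_space) atlas"
    and \<phi> :: "real ^ 'n \<Rightarrow> 'm"
  assumes "smooth_atlas A"
    and "diffeomorphism euclidean_atlas A \<phi>"
  shows "\<exists>h. riemannian_metric A h \<and>
    (\<forall>(f :: 'm \<Rightarrow> real) (\<eta> :: real) (y :: nat \<Rightarrow> real ^ 'n).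
       smooth_fun A f \<longrightarrow> \<eta> > 0 \<longrightarrow>
       (\<forall>t. (\<lambda>u. - \<eta> * riemannian_gradient A h f (\<phi> (y t)) u)
              \<in> riemannian_exp_domain A h (\<phi> (y t))) \<and>
       ((\<forall>t. y (Suc t) = y t - \<eta> *\<^sub>R euclidean_gradient (f \<circ> \<phi>) (y t)) \<longleftrightarrow>
        (\<forall>t. \<phi> (y (Suc t)) =
               riemannian_exp A h (\<phi> (y t))
                 (\<lambda>u. - \<eta> * riemannian_gradient A h f (\<phi> (y t)) u))))"
proof -
  interpret euclidean_diffeo A \<phi> using assms by unfold_locales
  have step: "(\<lambda>u. - \<eta> * riemannian_gradient A pullback_metric f (\<phi> x) u) =
      push (\<phi> x) (- \<eta> *\<^sub>R euclidean_gradient (f \<circ> \<phi>) x)" if "smooth_fun A f" for f \<eta> x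
    by (intro ext) (simp only: push_scaleR riemannian_gradient_pullback[OF that] inv_diffeo)
  have inj: "\<phi> x = \<phi> z \<longleftrightarrow> x = z" for x z
    by (metis inv_diffeo(1))
  show ?thesis
    \<comment> \<open>The witness is built from \<open>\<phi>\<close> before \<open>f\<close>,
      \<open>\<eta>\<close> and \<open>y\<close> are chosen. Rewriting turns the Riemannian step
      into the \<open>\<phi>\<close>-image of the Euclidean one, and \<open>inj\<close> cancels
      \<open>\<phi>\<close>.\<close>
    by (intro exI[of _ pullback_metric] conjI riemannian_metric_pullback allI impI)
      (simp_all only: step riemannian_exp_domain_pullback riemannian_exp_pullback inv_diffeo inj
        scaleR_minus_left add_uminus_conv_diff)
qed

end
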